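(* Let $\alpha\in(0,1)$ and let $\varphi:\mathbb{R}\to\mathbb{R}$ be continuous. The fractional differential equation $${}^{c}D^{\alpha}u(t)=\varphi(u(t))$$ has no periodic solutions with the exception of constant functions: if $u:\mathbb{R}\to\mathbb{R}$ is locally absolutely continuous, is $T$-periodic for some $T>0$, and satisfies ${}^{c}D^{\alpha}u(t)=\varphi(u(t))$ for almost every $t\ge 0$, then there is $u_0\in\mathbb{R}$ such that $u(t)=u_0$ for all $t\in\mathbb{R}$ and $\varphi(u_0)=0$.
   Context: For $\alpha\in(0,1)$ and a locally absolutely continuous function $u$, the Caputo fractional derivative of order $\alpha$ is $${}^{c}D^{\alpha}u(t)=\frac{1}{\Gamma(1-\alpha)}\int_0^t (t-s)^{-\alpha}u'(s)\,ds,$$ defined for almost every $t\ge 0$. A function $u:\mathbb{R}\to\mathbb{R}$ is $T$-periodic if $u(t+T)=u(t)$ for all $t\in\mathbb{R}$. *)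

theory Defs
  imports "HOL-Analysis.Analysis"
begin

(* The epsilon-delta notion for functions; the library constant absolutely_continuous
   is about measures. D is a finite family of pairwise non-overlapping intervals,
   each encoded by its pair of endpoints. *)
definition abs_continuous_on :: "real set \<Rightarrow> (real \<Rightarrow> real) \<Rightarrow> bool" where
  "abs_continuous_on S u \<longleftrightarrow>
     (\<forall>\<epsilon>>0. \<exists>\<delta>>0. \<forall>D :: (real \<times> real) set.
        finite D \<and> (\<forall>(x, y)\<in>D. x < y \<and> {x..y} \<subseteq> S) \<and>
        disjoint_family_on (\<lambda>(x, y). {x<..<y}) D \<and>
        (\<Sum>(x, y)\<in>D. y - x) < \<delta>
        \<longrightarrow> (\<Sum>(x, y)\<in>D. \<bar>u y - u x\<bar>) < \<epsilon>)"

definition locally_abs_continuous :: "(real \<Rightarrow> real) \<Rightarrow> bool" where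
  "locally_abs_continuous u \<longleftrightarrow> (\<forall>a b. abs_continuous_on {a..b} u)"

(* For locally absolutely continuous u, the function u is differentiable almost everywhere,
   so the arbitrary values of deriv at the remaining points do not affect the integral, and
   the integrand is Lebesgue integrable for almost every t \<ge> 0; the default value 0 of the
   Lebesgue integral is therefore only taken on a null set of such t. The measure is the
   completed one because deriv u need not be Borel measurable. *)
definition caputo_deriv :: "real \<Rightarrow> (real \<Rightarrow> real) \<Rightarrow> real \<Rightarrow> real" where
  "caputo_deriv \<alpha> u t =
     1 / Gamma (1 - \<alpha>) * (LINT s:{0..t}|lebesgue. (t - s) powr (- \<alpha>) * deriv u s)"

end

theory Submission
  imports Defs
begin

text \<open>
  The Caputo derivative remembers the time at which it starts, and this is incompatible with
  periodicity. If \<open>u\<close> is a \<open>T\<close>-periodic solution, then the Caputo derivatives of \<open>u\<close> at \<open>t\<close> and at \<open>t + T\<close>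
  are both \<open>\<phi> (u t)\<close>. A shift by \<open>T\<close> turns the integral over \<open>{0..t + T}\<close> into an integral over
  \<open>{-T..t}\<close> with the kernel \<open>(t - s) powr (- \<alpha>)\<close>. So the part of it over \<open>{-T..0}\<close> vanishes: for almost
  every, hence by continuity for every \<open>t\<close> in \<open>(0, T)\<close>, the integral of \<open>(t - s) powr (- \<alpha>) * u' s\<close> over
  \<open>s\<close> in \<open>{-T..0}\<close> is 0.

  This forces \<open>u' = 0\<close> almost everywhere on the period. Differentiation in \<open>t\<close> gives the same identity for
  the kernels \<open>(t - s) powr (- \<alpha> - k)\<close>, which are a fixed positive function times the powers of
  \<open>1 / (t - s)\<close>, and the Weierstrass theorem extends it to all continuous test functions. This is
  \<open>powr_kernel_integral_zero_imp_integral_zero\<close>, which is stated so that it yields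
  \<open>u x - u (- T) = 0\<close> directly. Hence \<open>u\<close> is constant, its Caputo derivative is 0, and so is
  \<open>\<phi>\<close> at the constant value.

  The argument rests on the fundamental theorem of calculus for absolutely continuous functions:
  \<open>u\<close> is differentiable almost everywhere, and its derivative is integrable with integral the increment
  of \<open>u\<close> (\<open>abs_continuous_on_fundamental_theorem\<close>). Its proof writes \<open>u\<close> as a difference of two
  monotone absolutely continuous functions by means of the variation of \<open>u\<close>, obtains a density of each
  from the Radon-Nikodym theorem, and identifies the density with the derivative by Lebesgue's
  differentiation theorem, which is derived from the Vitali covering theorem.
\<close>

section \<open>Variation of absolutely continuous functions\<close>

definition interval_family :: "real \<Rightarrow> real \<Rightarrow> (real \<times> real) set \<Rightarrow> bool" where
  "interval_family a b D \<longleftrightarrow>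
     finite D \<and> (\<forall>(x, y)\<in>D. x < y \<and> {x..y} \<subseteq> {a..b}) \<and>
     disjoint_family_on (\<lambda>(x, y). {x<..<y}) D"

definition variation_sum :: "(real \<Rightarrow> real) \<Rightarrow> (real \<times> real) set \<Rightarrow> real" where
  "variation_sum u D = (\<Sum>(x, y)\<in>D. \<bar>u y - u x\<bar>)"

text \<open>The supremum runs over families with gaps instead of partitions. Gaps leave its value unchanged, and
  the sums are then literally those in the definition of absolute continuity.\<close>

definition variation :: "(real \<Rightarrow> real) \<Rightarrow> real \<Rightarrow> real \<Rightarrow> real" where
  "variation u a b = (SUP D\<in>{D. interval_family a b D}. variation_sum u D)"

definition bounded_variation :: "(real \<Rightarrow> real) \<Rightarrow> real \<Rightarrow> real \<Rightarrow> bool" where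
  "bounded_variation u a b \<longleftrightarrow> bdd_above (variation_sum u ` {D. interval_family a b D})"

lemma interval_family_iff:
  "interval_family a b D \<longleftrightarrow>
     finite D \<and> (\<forall>x y. (x, y) \<in> D \<longrightarrow> a \<le> x \<and> x < y \<and> y \<le> b) \<and>
     (\<forall>x y x' y'. (x, y) \<in> D \<longrightarrow> (x', y') \<in> D \<longrightarrow> (x, y) \<noteq> (x', y') \<longrightarrow> y \<le> x' \<or> y' \<le> x)"
proof -
  have "{x<..<y} \<inter> {x'<..<y'} = {} \<longleftrightarrow> y \<le> x' \<or> y' \<le> x" if "x < y" "x' < y'" for x y x' y' :: real
  proof
    assume e: "{x<..<y} \<inter> {x'<..<y'} = {}"
    show "y \<le> x' \<or> y' \<le> x"
    proof (rule ccontr)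
      assume "\<not> (y \<le> x' \<or> y' \<le> x)"
      then have "max x x' < min y y'" using that by auto
      then obtain m where "max x x' < m" "m < min y y'" using dense by blast
      then show False using e by auto
    qed
  qed auto
  then have "{x<..<y} \<inter> {x'<..<y'} = {} \<longleftrightarrow> y \<le> x' \<or> y' \<le> x" if "x < y \<and> {x..y} \<subseteq> {a..b}" "x' < y'\<and> {x'..y'} \<subseteq> {a..b}" for x y x' y' :: real
    using that by blast
  then show ?thesis
    unfolding interval_family_def disjoint_family_on_def Ball_def split_paired_All split_conv
    by (smt (verit, ccfv_threshold) atLeastatMost_subset_iff)
qed

lemma abs_continuous_on_interval_iff:
  "abs_continuous_on {a..b} u \<longleftrightarrow>
     (\<forall>\<epsilon>>0. \<exists>\<delta>>0. \<forall>D. interval_family a b D \<longrightarrow> (\<Sum>(x, y)\<in>D. y - x) < \<delta> \<longrightarrow> variation_sum u D < \<epsilon>)"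
  unfolding abs_continuous_on_def interval_family_def variation_sum_def
  by (simp only: conj_assoc imp_conjL)

lemma abs_continuous_onE:
  assumes "abs_continuous_on {a..b} u" "e > 0"
  obtains d where "d > 0"
    "\<And>D. interval_family a b D \<Longrightarrow> (\<Sum>(x, y)\<in>D. y - x) < d \<Longrightarrow> variation_sum u D < e"
  using assms unfolding abs_continuous_on_interval_iff by meson

lemma interval_family_empty [simp]: "interval_family a b {}"
  by (simp add: interval_family_iff)

lemma variation_sum_empty [simp]: "variation_sum u {} = 0"
  by (simp add: variation_sum_def)

lemma interval_family_mono:
  "interval_family a b D \<Longrightarrow> a' \<le> a \<Longrightarrow> b \<le> b' \<Longrightarrow> interval_family a' b' D"
  unfolding interval_family_iff by force

lemma interval_family_singleton: "a \<le> x \<Longrightarrow> x < y \<Longrightarrow> y \<le> b \<Longrightarrow> interval_family a b {(x, y)}"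
  unfolding interval_family_iff by auto

text \<open>The intervals of the family are disjoint, so their total length is the measure of their union.\<close>

lemma interval_family_length:
  assumes D: "interval_family a b D" and "a \<le> b"
  shows "(\<Sum>(x, y)\<in>D. y - x) \<le> b - a"
proof -
  have fin: "finite D" using D by (simp add: interval_family_def)
  have "(\<Sum>(x, y)\<in>D. y - x) = (\<Sum>p\<in>D. measure lborel {fst p<..<snd p})"
    using D by (intro sum.cong) (auto simp: interval_family_iff less_imp_le)
  also have "\<dots> = measure lborel (\<Union>p\<in>D. {fst p<..<snd p})"
  proof (rule measure_finite_Union[symmetric, OF fin])
    show "disjoint_family_on (\<lambda>p. {fst p<..<snd p}) D"
      using D by (simp add: interval_family_def case_prod_unfold)
    show "emeasure lborel {fst p<..<snd p} \<noteq> \<infinity>" if "p \<in> D" for p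
      by (cases "fst p \<le> snd p") auto
  qed auto
  also have "\<dots> \<le> measure lborel {a..b}"
  proof (rule measure_mono_fmeasurable)
    show "(\<Union>p\<in>D. {fst p<..<snd p}) \<subseteq> {a..b}"
      using D by (fastforce simp: interval_family_iff)
    show "(\<Union>p\<in>D. {fst p<..<snd p}) \<in> sets lborel"
      using fin by (intro sets.finite_UN) auto
    show "{a..b} \<in> fmeasurable lborel" using \<open>a \<le> b\<close> by (simp add: fmeasurable_def)
  qed
  finally show ?thesis using \<open>a \<le> b\<close> by simp
qed

text \<open>An interval of the family that straddles the cut point is divided there, and the
  triangle inequality controls its increment. This is the source of the subadditivity of the
  variation.\<close>

lemma interval_family_split:
  assumes D: "interval_family a c D" and "a \<le> b" "b \<le> c"
  obtains D1 D2 where "interval_family a b D1" "interval_family b c D2"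
    "variation_sum u D \<le> variation_sum u D1 + variation_sum u D2"
proof -
  define L where "L = {p\<in>D. fst p < b}"
  define R where "R = {p\<in>D. b < snd p}"
  define D1 where "D1 = (\<lambda>p. (fst p, min (snd p) b)) ` L"
  define D2 where "D2 = (\<lambda>p. (max (fst p) b, snd p)) ` R"
  have fin: "finite D" and mem: "\<And>x y. (x, y) \<in> D \<Longrightarrow> a \<le> x \<and> x < y \<and> y \<le> c"
    and disj: "\<And>x y x' y'. (x, y) \<in> D \<Longrightarrow> (x', y') \<in> D \<Longrightarrow> (x, y) \<noteq> (x', y') \<Longrightarrow> y \<le> x' \<or> y' \<le> x"
    using D unfolding interval_family_iff by blast+
  have inj1: "inj_on (\<lambda>p. (fst p, min (snd p) b)) L"
  proof (rule inj_onI, rule ccontr)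
    fix p q assume pq: "p \<in> L" "q \<in> L" "(fst p, min (snd p) b) = (fst q, min (snd q) b)" "p \<noteq> q"
    then have "p \<in> D" "q \<in> D" "fst p = fst q" by (auto simp: L_def)
    then show False
      using disj[of "fst p" "snd p" "fst q" "snd q"] mem[of "fst p" "snd p"] mem[of "fst q" "snd q"] pq(4)
      by (cases p; cases q) auto
  qed
  have inj2: "inj_on (\<lambda>p. (max (fst p) b, snd p)) R"
  proof (rule inj_onI, rule ccontr)
    fix p q assume pq: "p \<in> R" "q \<in> R" "(max (fst p) b, snd p) = (max (fst q) b, snd q)" "p \<noteq> q"
    then have "p \<in> D" "q \<in> D" "snd p = snd q" by (auto simp: R_def)
    then show False
      using disj[of "fst p" "snd p" "fst q" "snd q"] mem[of "fst p" "snd p"] mem[of "fst q" "snd q"] pq(4)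
      by (cases p; cases q) auto
  qed
  have "interval_family a b D1"
    unfolding interval_family_iff
  proof (intro conjI allI impI)
    show "finite D1" using fin by (simp add: D1_def L_def)
    show "a \<le> x" "x < y" "y \<le> b" if "(x, y) \<in> D1" for x y
      using that mem by (force simp: D1_def L_def)+
    show "y \<le> x' \<or> y' \<le> x" if "(x, y) \<in> D1" "(x', y') \<in> D1" "(x, y) \<noteq> (x', y')" for x y x' y'
    proof -
      obtain z z' where "(x, z) \<in> D" "(x', z') \<in> D" "y = min z b" "y' = min z' b"
        using \<open>(x, y) \<in> D1\<close> \<open>(x', y') \<in> D1\<close> by (auto simp: D1_def L_def)
      moreover from this have "(x, z) \<noteq> (x', z')" using that(3) by auto
      ultimately show ?thesis
        using disj[of x z x' z'] by (auto simp: min_le_iff_disj)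
    qed
  qed
  moreover have "interval_family b c D2"
    unfolding interval_family_iff
  proof (intro conjI allI impI)
    show "finite D2" using fin by (simp add: D2_def R_def)
    show "b \<le> x" "x < y" "y \<le> c" if "(x, y) \<in> D2" for x y
      using that mem by (force simp: D2_def R_def)+
    show "y \<le> x' \<or> y' \<le> x" if "(x, y) \<in> D2" "(x', y') \<in> D2" "(x, y) \<noteq> (x', y')" for x y x' y'
    proof -
      obtain z z' where "(z, y) \<in> D" "(z', y') \<in> D" "x = max z b" "x' = max z' b"
        using \<open>(x, y) \<in> D2\<close> \<open>(x', y') \<in> D2\<close> by (auto simp: D2_def R_def)
      moreover from this have "(z, y) \<noteq> (z', y')" using that(3) by auto
      ultimately show ?thesis
        using disj[of z y z' y'] by (auto simp: le_max_iff_disj)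
    qed
  qed
  moreover have "variation_sum u D \<le> variation_sum u D1 + variation_sum u D2"
  proof -
    have "variation_sum u D1 = (\<Sum>p\<in>L. \<bar>u (min (snd p) b) - u (fst p)\<bar>)"
      unfolding variation_sum_def D1_def by (subst sum.reindex[OF inj1]) (simp add: case_prod_beta)
    also have "\<dots> = (\<Sum>p\<in>D. if fst p < b then \<bar>u (min (snd p) b) - u (fst p)\<bar> else 0)"
      unfolding L_def using fin by (rule sum.inter_filter)
    finally have 1: "variation_sum u D1 = \<dots>" .
    have "variation_sum u D2 = (\<Sum>p\<in>R. \<bar>u (snd p) - u (max (fst p) b)\<bar>)"
      unfolding variation_sum_def D2_def by (subst sum.reindex[OF inj2]) (simp add: case_prod_beta)
    also have "\<dots> = (\<Sum>p\<in>D. if b < snd p then \<bar>u (snd p) - u (max (fst p) b)\<bar> else 0)"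
      unfolding R_def using fin by (rule sum.inter_filter)
    finally have 2: "variation_sum u D2 = \<dots>" .
    show ?thesis
      unfolding 1 2 sum.distrib[symmetric] unfolding variation_sum_def
    proof (rule sum_mono)
      fix p assume "p \<in> D"
      then have "fst p < snd p" using mem[of "fst p" "snd p"] by auto
      then show "(case p of (x, y) \<Rightarrow> \<bar>u y - u x\<bar>) \<le>
        (if fst p < b then \<bar>u (min (snd p) b) - u (fst p)\<bar> else 0) +
        (if b < snd p then \<bar>u (snd p) - u (max (fst p) b)\<bar> else 0)"
        by (auto simp: case_prod_beta min_def max_def)
    qed
  qed
  ultimately show thesis by (rule that)
qed

lemma interval_family_Un:
  assumes "interval_family a b D1" "interval_family b c D2" "a \<le> b" "b \<le> c"
  shows "interval_family a c (D1 \<union> D2)" "D1 \<inter> D2 = {}"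
proof -
  have 1: "finite D1" "\<And>x y. (x, y) \<in> D1 \<Longrightarrow> a \<le> x \<and> x < y \<and> y \<le> b"
    "\<And>x y x' y'. (x, y) \<in> D1 \<Longrightarrow> (x', y') \<in> D1 \<Longrightarrow> (x, y) \<noteq> (x', y') \<Longrightarrow> y \<le> x' \<or> y' \<le> x"
    using assms(1) unfolding interval_family_iff by blast+
  have 2: "finite D2" "\<And>x y. (x, y) \<in> D2 \<Longrightarrow> b \<le> x \<and> x < y \<and> y \<le> c"
    "\<And>x y x' y'. (x, y) \<in> D2 \<Longrightarrow> (x', y') \<in> D2 \<Longrightarrow> (x, y) \<noteq> (x', y') \<Longrightarrow> y \<le> x' \<or> y' \<le> x"
    using assms(2) unfolding interval_family_iff by blast+
  show "interval_family a c (D1 \<union> D2)"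
    unfolding interval_family_iff
  proof (intro conjI allI impI)
    show "finite (D1 \<union> D2)" using 1 2 by simp
    show "a \<le> x" "x < y" "y \<le> c" if "(x, y) \<in> D1 \<union> D2" for x y
      using that 1(2)[of x y] 2(2)[of x y] assms(3,4) by auto
    show "y \<le> x' \<or> y' \<le> x" if "(x, y) \<in> D1 \<union> D2" "(x', y') \<in> D1 \<union> D2" "(x, y) \<noteq> (x', y')" for x y x' y'
      using that 1(2)[of x y] 2(2)[of x y] 1(2)[of x' y'] 2(2)[of x' y'] 1(3)[of x y x' y'] 2(3)[of x y x' y']
      by auto
  qed
  show "D1 \<inter> D2 = {}"
    using 1(2) 2(2) by force
qed

lemma variation_sum_Un:
  "finite D1 \<Longrightarrow> finite D2 \<Longrightarrow> D1 \<inter> D2 = {} \<Longrightarrow>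
   variation_sum u (D1 \<union> D2) = variation_sum u D1 + variation_sum u D2"
  unfolding variation_sum_def by (rule sum.union_disjoint)

lemma variation_upper:
  "bounded_variation u a b \<Longrightarrow> interval_family a b D \<Longrightarrow> variation_sum u D \<le> variation u a b"
  unfolding bounded_variation_def variation_def by (rule cSUP_upper) auto

lemma variation_least:
  assumes "\<And>D. interval_family a b D \<Longrightarrow> variation_sum u D \<le> M"
  shows "variation u a b \<le> M"
  unfolding variation_def
proof (rule cSUP_least)
  show "{D. interval_family a b D} \<noteq> {}" using interval_family_empty by blast
qed (use assms in auto)

lemma variation_approx:
  assumes "e > 0"
  shows "\<exists>D. interval_family a b D \<and> variation u a b \<le> variation_sum u D + e"
proof (rule ccontr)
  assume "\<not> ?thesis"
  then have "variation u a b \<le> variation u a b - e"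
    by (intro variation_least) (force simp: not_le)
  then show False using assms by simp
qed

lemma bounded_variation_mono:
  "bounded_variation u a b \<Longrightarrow> a \<le> a' \<Longrightarrow> b' \<le> b \<Longrightarrow> bounded_variation u a' b'"
  unfolding bounded_variation_def
  by (erule bdd_above_mono) (auto intro: interval_family_mono)

lemma bounded_variation_combine:
  assumes "bounded_variation u a b" "bounded_variation u b c" "a \<le> b" "b \<le> c"
  shows "bounded_variation u a c"
  unfolding bounded_variation_def
proof (rule bdd_aboveI2)
  fix D assume "D \<in> {D. interval_family a c D}"
  then obtain D1 D2 where "interval_family a b D1" "interval_family b c D2"
    "variation_sum u D \<le> variation_sum u D1 + variation_sum u D2"
    using interval_family_split[OF _ assms(3,4), of D u] by blast
  then show "variation_sum u D \<le> variation u a b + variation u b c"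
    using variation_upper[OF assms(1)] variation_upper[OF assms(2)] by fastforce
qed

lemma variation_add:
  assumes bv: "bounded_variation u a c" and "a \<le> b" "b \<le> c"
  shows "variation u a c = variation u a b + variation u b c"
proof (rule antisym)
  have bv1: "bounded_variation u a b" and bv2: "bounded_variation u b c"
    using bv assms(2,3) by (auto intro: bounded_variation_mono)
  show "variation u a c \<le> variation u a b + variation u b c"
  proof (rule variation_least)
    fix D assume "interval_family a c D"
    then obtain D1 D2 where "interval_family a b D1" "interval_family b c D2"
      "variation_sum u D \<le> variation_sum u D1 + variation_sum u D2"
      using interval_family_split[OF _ assms(2,3), of D u] by blast
    then show "variation_sum u D \<le> variation u a b + variation u b c"
      using variation_upper[OF bv1] variation_upper[OF bv2] by fastforce
  qed
  show "variation u a b + variation u b c \<le> variation u a c"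
  proof (rule field_le_epsilon)
    fix e :: real assume "e > 0"
    then obtain D1 D2 where D: "interval_family a b D1" "variation u a b \<le> variation_sum u D1 + e/2"
        "interval_family b c D2" "variation u b c \<le> variation_sum u D2 + e/2"
      using variation_approx[of "e/2" a b u] variation_approx[of "e/2" b c u] by auto
    have "variation_sum u (D1 \<union> D2) = variation_sum u D1 + variation_sum u D2"
      using interval_family_Un(2)[OF D(1,3) assms(2,3)] D(1,3)
      by (intro variation_sum_Un) (auto simp: interval_family_def)
    then show "variation u a b + variation u b c \<le> variation u a c + e"
      using D variation_upper[OF bv interval_family_Un(1)[OF D(1,3) assms(2,3)]] by simp
  qed
qed

lemma abs_diff_le_variation:
  assumes "bounded_variation u a b" "a \<le> b"
  shows "\<bar>u b - u a\<bar> \<le> variation u a b"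
proof (cases "a = b")
  case True
  then show ?thesis using variation_upper[OF assms(1) interval_family_empty] by simp
next
  case False
  then show ?thesis
    using variation_upper[OF assms(1) interval_family_singleton[of a a b b]] assms(2)
    by (simp add: variation_sum_def)
qed

text \<open>On an interval shorter than the modulus for \<open>\<epsilon> = 1\<close> every variation sum is below 1, and bounded
  variation passes to adjacent unions; compactness in the form of Bolzano's lemma does the rest.\<close>

lemma abs_continuous_on_imp_bounded_variation:
  assumes "abs_continuous_on {a..b} u" "a \<le> b"
  shows "bounded_variation u a b"
proof -
  obtain d where "d > 0" and d: "\<And>D. interval_family a b D \<Longrightarrow> (\<Sum>(x, y)\<in>D. y - x) < d \<Longrightarrow> variation_sum u D < 1"
    using abs_continuous_onE[OF assms(1) zero_less_one] by blast
  define P where "P x y \<longleftrightarrow> (a \<le> x \<longrightarrow> y \<le> b \<longrightarrow> bounded_variation u x y)" for x y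
  have "P a b"
  proof (rule Bolzano)
    show "a \<le> b" by fact
    show "P x z" if "P x y" "P y z" "x \<le> y" "y \<le> z" for x y z
      using that bounded_variation_combine unfolding P_def by force
    show "\<exists>d>0. \<forall>x y. x \<le> z \<and> z \<le> y \<and> y - x < d \<longrightarrow> P x y" for z
    proof (intro exI[of _ d] conjI allI impI \<open>d > 0\<close>)
      fix x y assume xy: "x \<le> z \<and> z \<le> y \<and> y - x < d"
      show "P x y"
        unfolding P_def bounded_variation_def
      proof (intro impI bdd_aboveI2)
        fix D assume "a \<le> x" "y \<le> b" "D \<in> {D. interval_family x y D}"
        then show "variation_sum u D \<le> 1"
          using d[of D] interval_family_length[of x y D] xy interval_family_mono[of x y D a b] by fastforce
      qed
    qed
  qed
  then show ?thesis by (simp add: P_def)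
qed

text \<open>Each interval of a short family \<open>D\<close> is refined to a family \<open>S p\<close> that nearly attains its variation.
  All refinements together form a family that is no longer than \<open>D\<close>, so the absolute continuity of
  \<open>u\<close> bounds the sum of the variations.\<close>

lemma abs_continuous_on_variation:
  assumes ac: "abs_continuous_on {a..b} u" and "a \<le> b"
  shows "abs_continuous_on {a..b} (variation u a)"
  unfolding abs_continuous_on_interval_iff
proof (intro allI impI)
  fix e :: real assume "e > 0"
  then obtain d where "d > 0" and
    d: "\<And>D. interval_family a b D \<Longrightarrow> (\<Sum>(x, y)\<in>D. y - x) < d \<Longrightarrow> variation_sum u D < e/2"
    using ac unfolding abs_continuous_on_interval_iff by (meson half_gt_zero)
  have bv: "bounded_variation u a b"
    using assms by (rule abs_continuous_on_imp_bounded_variation)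
  show "\<exists>d>0. \<forall>D. interval_family a b D \<longrightarrow> (\<Sum>(x, y)\<in>D. y - x) < d \<longrightarrow> variation_sum (variation u a) D < e"
  proof (intro exI[of _ d] conjI allI impI \<open>d > 0\<close>)
    fix D assume D: "interval_family a b D" and len: "(\<Sum>(x, y)\<in>D. y - x) < d"
    have fin: "finite D" and mem: "\<And>x y. (x, y) \<in> D \<Longrightarrow> a \<le> x \<and> x < y \<and> y \<le> b"
      and disj: "\<And>x y x' y'. (x, y) \<in> D \<Longrightarrow> (x', y') \<in> D \<Longrightarrow> (x, y) \<noteq> (x', y') \<Longrightarrow> y \<le> x' \<or> y' \<le> x"
      using D unfolding interval_family_iff by blast+
    \<comment> \<open>The refinements lose at most half of \<open>e\<close> in total; the added 1 avoids division by zero.\<close>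
    define \<eta> where "\<eta> = e / (2 * (real (card D) + 1))"
    have "\<eta> > 0" using \<open>e > 0\<close> by (simp add: \<eta>_def)
    then have "\<forall>p. \<exists>D'. interval_family (fst p) (snd p) D' \<and>
        variation u (fst p) (snd p) \<le> variation_sum u D' + \<eta>"
      using variation_approx by blast
    then obtain S where S: "\<And>p. interval_family (fst p) (snd p) (S p)"
      and Sv: "\<And>p. variation u (fst p) (snd p) \<le> variation_sum u (S p) + \<eta>"
      by metis
    have Sfin: "finite (S p)" and Smem: "\<And>x y. (x, y) \<in> S p \<Longrightarrow> fst p \<le> x \<and> x < y \<and> y \<le> snd p"
      and Sdisj: "\<And>x y x' y'. (x, y) \<in> S p \<Longrightarrow> (x', y') \<in> S p \<Longrightarrow> (x, y) \<noteq> (x', y') \<Longrightarrow> y \<le> x' \<or> y' \<le> x" for p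
      using S[of p] unfolding interval_family_iff by blast+
    have S_inter: "S p \<inter> S q = {}" if "p \<in> D" "q \<in> D" "p \<noteq> q" for p q
    proof -
      have "snd p \<le> fst q \<or> snd q \<le> fst p"
        using disj[of "fst p" "snd p" "fst q" "snd q"] that by auto
      then show ?thesis using Smem[of _ _ p] Smem[of _ _ q] by force
    qed
    have fam: "interval_family a b (\<Union>p\<in>D. S p)"
      unfolding interval_family_iff
    proof (intro conjI allI impI)
      show "finite (\<Union>p\<in>D. S p)" using fin Sfin by blast
      show "a \<le> x" "x < y" "y \<le> b" if "(x, y) \<in> (\<Union>p\<in>D. S p)" for x y
        using that mem Smem by fastforce+
      show "y \<le> x' \<or> y' \<le> x"
        if xy: "(x, y) \<in> (\<Union>p\<in>D. S p)" and xy': "(x', y') \<in> (\<Union>p\<in>D. S p)" and ne: "(x, y) \<noteq> (x', y')" for x y x' y'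
      proof -
        obtain p q where pq: "p \<in> D" "q \<in> D" "(x, y) \<in> S p" "(x', y') \<in> S q" using xy xy' by blast
        show ?thesis
        proof (cases "p = q")
          case True
          then show ?thesis using Sdisj pq ne by blast
        next
          case False
          then have "snd p \<le> fst q \<or> snd q \<le> fst p"
            using disj[of "fst p" "snd p" "fst q" "snd q"] pq by auto
          then show ?thesis using Smem[OF pq(3)] Smem[OF pq(4)] by auto
        qed
      qed
    qed
    have sumU: "sum f (\<Union>p\<in>D. S p) = (\<Sum>p\<in>D. sum f (S p))" for f :: "real \<times> real \<Rightarrow> real"
      using fin Sfin S_inter by (intro sum.UNION_disjoint) auto
    have "(\<Sum>(x, y)\<in>(\<Union>p\<in>D. S p). y - x) = (\<Sum>p\<in>D. \<Sum>(x, y)\<in>S p. y - x)"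
      by (rule sumU)
    also have "\<dots> \<le> (\<Sum>p\<in>D. snd p - fst p)"
      using S mem by (intro sum_mono interval_family_length) (auto simp: less_imp_le)
    also have "\<dots> < d" using len by (simp add: case_prod_beta)
    finally have *: "variation_sum u (\<Union>p\<in>D. S p) < e/2"
      using d[OF fam] by blast
    have "variation_sum (variation u a) D = (\<Sum>p\<in>D. variation u (fst p) (snd p))"
      unfolding variation_sum_def
    proof (rule sum.cong[OF refl])
      fix p assume "p \<in> D"
      then have p: "a \<le> fst p" "fst p < snd p" "snd p \<le> b" using mem[of "fst p" "snd p"] by auto
      have bv': "bounded_variation u a (snd p)" using bv p by (auto intro: bounded_variation_mono)
      have "0 \<le> variation u (fst p) (snd p)"
        using abs_diff_le_variation[OF bounded_variation_mono[OF bv' p(1)], of "snd p"] p by simp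
      then show "(case p of (x, y) \<Rightarrow> \<bar>variation u a y - variation u a x\<bar>) = variation u (fst p) (snd p)"
        using variation_add[OF bv', of "fst p"] p by (simp add: case_prod_beta)
    qed
    also have "\<dots> \<le> (\<Sum>p\<in>D. variation_sum u (S p) + \<eta>)"
      by (intro sum_mono Sv)
    also have "\<dots> = variation_sum u (\<Union>p\<in>D. S p) + card D * \<eta>"
      unfolding variation_sum_def sumU by (simp add: sum.distrib)
    also have "\<dots> < e"
    proof -
      have "card D * \<eta> \<le> e/2"
        using \<open>e > 0\<close> by (simp add: \<eta>_def field_simps)
      then show ?thesis using * by simp
    qed
    finally show "variation_sum (variation u a) D < e" .
  qed
qed

lemma abs_continuous_on_diff:
  assumes "abs_continuous_on {a..b} u" "abs_continuous_on {a..b} v"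
  shows "abs_continuous_on {a..b} (\<lambda>x. u x - v x)"
  unfolding abs_continuous_on_interval_iff
proof (intro allI impI)
  fix e :: real assume "e > 0"
  then have "e/2 > 0" by simp
  obtain d1 where d1: "d1 > 0"
    "\<And>D. interval_family a b D \<Longrightarrow> (\<Sum>(x, y)\<in>D. y - x) < d1 \<Longrightarrow> variation_sum u D < e/2"
    using abs_continuous_onE[OF assms(1) \<open>e/2 > 0\<close>] by blast
  obtain d2 where d2: "d2 > 0"
    "\<And>D. interval_family a b D \<Longrightarrow> (\<Sum>(x, y)\<in>D. y - x) < d2 \<Longrightarrow> variation_sum v D < e/2"
    using abs_continuous_onE[OF assms(2) \<open>e/2 > 0\<close>] by blast
  have le: "variation_sum (\<lambda>x. u x - v x) D \<le> variation_sum u D + variation_sum v D" for D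
    unfolding variation_sum_def sum.distrib[symmetric] by (intro sum_mono) auto
  show "\<exists>d>0. \<forall>D. interval_family a b D \<longrightarrow> (\<Sum>(x, y)\<in>D. y - x) < d \<longrightarrow> variation_sum (\<lambda>x. u x - v x) D < e"
  proof (intro exI[of _ "min d1 d2"] conjI allI impI)
    fix D assume "interval_family a b D" "(\<Sum>(x, y)\<in>D. y - x) < min d1 d2"
    then show "variation_sum (\<lambda>x. u x - v x) D < e"
      using d1(2)[of D] d2(2)[of D] le[of D] by simp
  qed (use d1 d2 in simp)
qed

lemma abs_continuous_on_imp_continuous_on:
  assumes "abs_continuous_on {a..b} u"
  shows "continuous_on {a..b} u"
  unfolding continuous_on_iff
proof (intro ballI allI impI)
  fix x e :: real assume x: "x \<in> {a..b}" and "e > 0"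
  then obtain d where d: "d > 0"
    "\<And>D. interval_family a b D \<Longrightarrow> (\<Sum>(x, y)\<in>D. y - x) < d \<Longrightarrow> variation_sum u D < e"
    using assms unfolding abs_continuous_on_interval_iff by meson
  show "\<exists>d>0. \<forall>y\<in>{a..b}. dist y x < d \<longrightarrow> dist (u y) (u x) < e"
  proof (intro exI[of _ d] conjI ballI impI)
    fix y assume y: "y \<in> {a..b}" "dist y x < d"
    show "dist (u y) (u x) < e"
      using x y \<open>e > 0\<close> d(2)[OF interval_family_singleton[of a "min x y" "max x y" b]]
      by (cases x y rule: linorder_cases) (auto simp: variation_sum_def dist_real_def abs_minus_commute)
  qed (use d in simp)
qed

section \<open>Absolutely continuous functions as indefinite integrals\<close>

lemma integrable_imp_set_integrable:
  fixes f :: "'a \<Rightarrow> 'b::{banach, second_countable_topology}"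
  shows "integrable M f \<Longrightarrow> A \<in> sets M \<Longrightarrow> set_integrable M A f"
  unfolding set_integrable_def by (rule integrable_mult_indicator)

text \<open>A null set is covered by countably many closed intervals with disjoint interiors and small total
  length. Absolute continuity makes the measure of every finite part of the cover small, and
  continuity from below passes to the whole cover.\<close>

lemma interval_measure_null_set_of_abs_continuous:
  assumes "a < b" and mono: "\<And>x y. x \<le> y \<Longrightarrow> F x \<le> F y" and cont: "continuous_on UNIV F"
    and ac: "abs_continuous_on {a..b} F"
    and N: "N \<in> null_sets lborel" "N \<subseteq> {a..b}"
  shows "N \<in> null_sets (interval_measure F)"
proof -
  let ?M = "interval_measure F"
  have "emeasure ?M N \<le> ennreal e" if "e > 0" for e
  proof -
    obtain d where "d > 0" and
      d: "\<And>D. interval_family a b D \<Longrightarrow> (\<Sum>(x, y)\<in>D. y - x) < d \<Longrightarrow> variation_sum F D < e"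
      using abs_continuous_onE[OF ac \<open>e > 0\<close>] by blast
    have "negligible N"
      unfolding negligible_iff_null_sets using N(1) by (rule null_sets_completionI)
    then have Nl: "N \<in> lmeasurable" "measure lebesgue N = 0"
      by (simp_all add: negligible_imp_measurable negligible_imp_measure0)
    have "N \<subseteq> cbox a b" "d/2 > 0" using N(2) \<open>d > 0\<close> by auto
    note cover = measurable_outer_intervals_bounded[OF Nl(1) this]
    obtain \<D> where \<D>: "countable \<D>"
        "\<And>K. K \<in> \<D> \<Longrightarrow> K \<subseteq> cbox a b \<and> K \<noteq> {} \<and> (\<exists>c d. K = cbox c d)"
        "pairwise (\<lambda>A B. interior A \<inter> interior B = {}) \<D>"
        "\<And>K. \<lbrakk>K \<in> \<D>; box a b \<noteq> {}\<rbrakk> \<Longrightarrow> interior K \<noteq> {}"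
        "N \<subseteq> \<Union>\<D>" "\<Union>\<D> \<in> lmeasurable" "measure lebesgue (\<Union>\<D>) \<le> measure lebesgue N + d/2"
      by (rule cover) (rule that, assumption+)
    have K: "a \<le> Inf K \<and> Inf K < Sup K \<and> Sup K \<le> b \<and> K = {Inf K..Sup K}" if KD: "K \<in> \<D>" for K
    proof -
      obtain x y where xy: "K = cbox x y" using \<D>(2)[OF KD] by blast
      have "interior K \<noteq> {}" using \<D>(4)[OF KD] \<open>a < b\<close> by simp
      then have "x < y" using xy by simp
      then show ?thesis using xy \<D>(2)[OF KD] by simp
    qed
    then have Keq: "K = {Inf K..Sup K}" and Kb: "a \<le> Inf K" "Inf K < Sup K" "Sup K \<le> b" "F (Inf K) \<le> F (Sup K)"
      if "K \<in> \<D>" for K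
      using that mono by (blast, blast, blast, blast, meson less_imp_le)
    have fin_le: "emeasure ?M (\<Union>\<D>') \<le> ennreal e" if D': "finite \<D>'" "\<D>' \<subseteq> \<D>" for \<D>'
    proof -
      define D where "D = (\<lambda>K. (Inf K, Sup K)) ` \<D>'"
      have inj: "inj_on (\<lambda>K. (Inf K, Sup K)) \<D>'"
      proof (rule inj_onI)
        fix K L assume KL: "K \<in> \<D>'" "L \<in> \<D>'" "(Inf K, Sup K) = (Inf L, Sup L)"
        then have "K = {Inf K..Sup K}" "L = {Inf L..Sup L}" using Keq D'(2) by blast+
        then show "K = L" using KL(3) by (metis Pair_inject)
      qed
      have fam: "interval_family a b D"
        unfolding interval_family_def
      proof (intro conjI)
        show "finite D" using D' by (simp add: D_def)
        show "\<forall>(x, y)\<in>D. x < y \<and> {x..y} \<subseteq> {a..b}"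
          using Kb D'(2) by (force simp: D_def)
        show "disjoint_family_on (\<lambda>(x, y). {x<..<y}) D"
          unfolding disjoint_family_on_def
        proof (intro ballI impI)
          fix p q assume "p \<in> D" "q \<in> D" "p \<noteq> q"
          then obtain K L where KL: "p = (Inf K, Sup K)" "q = (Inf L, Sup L)" "K \<in> \<D>" "L \<in> \<D>" "K \<noteq> L"
            using D'(2) by (auto simp: D_def)
          then have "interior K \<inter> interior L = {}" using \<D>(3) by (auto simp: pairwise_def)
          moreover have "interior K = {Inf K<..<Sup K}" "interior L = {Inf L<..<Sup L}"
            using Keq[OF KL(3)] Keq[OF KL(4)] by (metis interior_atLeastAtMost_real)+
          ultimately show "(case p of (x, y) \<Rightarrow> {x<..<y}) \<inter> (case q of (x, y) \<Rightarrow> {x<..<y}) = {}"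
            using KL by simp
        qed
      qed
      have "(\<Sum>(x, y)\<in>D. y - x) = (\<Sum>p\<in>D. measure lebesgue {fst p<..<snd p})"
        using fam by (intro sum.cong) (auto simp: interval_family_iff less_imp_le)
      also have "\<dots> = measure lebesgue (\<Union>p\<in>D. {fst p<..<snd p})"
      proof (rule measure_finite_Union[symmetric])
        show "finite D" "disjoint_family_on (\<lambda>p. {fst p<..<snd p}) D"
          using fam by (simp_all add: interval_family_def case_prod_unfold)
        show "emeasure lebesgue {fst p<..<snd p} \<noteq> \<infinity>" if "p \<in> D" for p
          by (cases "fst p \<le> snd p") auto
      qed auto
      also have "\<dots> \<le> measure lebesgue (\<Union>\<D>)"
      proof (rule measure_mono_fmeasurable)
        show "(\<Union>p\<in>D. {fst p<..<snd p}) \<subseteq> \<Union>\<D>"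
        proof (rule UN_least)
          fix p assume "p \<in> D"
          then obtain K' where "p = (Inf K', Sup K')" "K' \<in> \<D>" using D'(2) by (auto simp: D_def)
          then show "{fst p<..<snd p} \<subseteq> \<Union>\<D>" using Keq[of K'] by (metis Union_upper fst_conv greaterThanLessThan_subseteq_atLeastAtMost_iff order_refl order_trans snd_conv)
        qed
        show "(\<Union>p\<in>D. {fst p<..<snd p}) \<in> sets lebesgue"
          using fam by (intro sets.finite_UN) (auto simp: interval_family_def)
      qed fact
      also have "\<dots> < d" using \<D>(7) Nl \<open>d > 0\<close> by simp
      finally have "variation_sum F D < e" using d fam by blast
      moreover have "variation_sum F D = (\<Sum>K\<in>\<D>'. F (Sup K) - F (Inf K))"
        unfolding variation_sum_def D_def sum.reindex[OF inj] using Kb D'(2)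
        by (intro sum.cong) (auto simp: subset_iff)
      ultimately have *: "(\<Sum>K\<in>\<D>'. F (Sup K) - F (Inf K)) < e" by simp
      have meas: "K' \<in> sets ?M" "emeasure ?M K' = ennreal (F (Sup K') - F (Inf K'))" if "K' \<in> \<D>'" for K'
      proof -
        have "K' \<in> \<D>" using D' that by blast
        then have e: "K' = {Inf K'..Sup K'}" "Inf K' \<le> Sup K'"
          using Keq Kb(2) less_imp_le by blast+
        show "K' \<in> sets ?M" by (subst e(1)) simp
        show "emeasure ?M K' = ennreal (F (Sup K') - F (Inf K'))"
          by (subst e(1)) (rule emeasure_interval_measure_Icc[OF e(2) mono cont])
      qed
      have "emeasure ?M (\<Union>\<D>') \<le> (\<Sum>K\<in>\<D>'. emeasure ?M K)"
        using emeasure_subadditive_finite[of \<D>' "\<lambda>K. K" ?M] D' meas(1) by auto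
      also have "\<dots> = (\<Sum>K\<in>\<D>'. ennreal (F (Sup K) - F (Inf K)))"
        using meas(2) by (intro sum.cong) auto
      also have "\<dots> = ennreal (\<Sum>K\<in>\<D>'. F (Sup K) - F (Inf K))"
      proof (rule sum_ennreal)
        fix K' assume "K' \<in> \<D>'"
        then show "0 \<le> F (Sup K') - F (Inf K')" using Kb(4)[of K'] D' by auto
      qed
      also have "\<dots> \<le> ennreal e" using * by (simp add: ennreal_leI)
      finally show ?thesis .
    qed
    have sets_D: "K' \<in> sets borel" if "K' \<in> \<D>" for K'
      using \<D>(2)[OF that] by auto
    have "emeasure ?M (\<Union>\<D>) \<le> ennreal e"
    proof (cases "\<D> = {}")
      case False
      define A where "A n = (\<Union>i\<le>n. from_nat_into \<D> i)" for n
      have A_eq: "A n = \<Union>(from_nat_into \<D> ` {..n})" for n by (simp add: A_def)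
      have sub: "from_nat_into \<D> ` {..n} \<subseteq> \<D>" for n
        using from_nat_into[OF False] by blast
      have "(\<lambda>n. emeasure ?M (A n)) \<longlonglongrightarrow> emeasure ?M (\<Union>n. A n)"
      proof (rule Lim_emeasure_incseq)
        show "range A \<subseteq> sets ?M"
          using sub sets_D by (auto simp: A_def intro!: sets.finite_UN)
        show "incseq A" by (force simp: incseq_def A_def)
      qed
      moreover have "(\<Union>n. A n) = \<Union>\<D>"
      proof -
        have "(\<Union>n. A n) = \<Union>(range (from_nat_into \<D>))" by (auto simp: A_def)
        then show ?thesis using range_from_nat_into[OF False \<D>(1)] by simp
      qed
      moreover have "emeasure ?M (A n) \<le> ennreal e" for n
        unfolding A_eq by (rule fin_le) (use sub in auto)
      ultimately show ?thesis
        using LIMSEQ_le_const2[of "\<lambda>n. emeasure ?M (A n)" "emeasure ?M (\<Union>\<D>)" "ennreal e"] by simp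
    qed simp
    moreover have "emeasure ?M N \<le> emeasure ?M (\<Union>\<D>)"
    proof (rule emeasure_mono[OF \<D>(5)])
      show "\<Union>\<D> \<in> sets ?M"
        using \<D>(1) sets_D by (intro sets.countable_Union) auto
    qed
    ultimately show ?thesis by (rule order_trans[rotated])
  qed
  then have "emeasure ?M N \<le> 0"
    by - (rule ennreal_le_epsilon, simp)
  moreover have "N \<in> sets ?M" using N(1) by (simp add: null_sets_def)
  ultimately show ?thesis by (intro null_setsI) simp_all
qed

text \<open>Stieltjes measures turn the problem into the Radon-Nikodym theorem: the measure of \<open>F\<close> is absolutely
  continuous with respect to Lebesgue measure, and \<open>g\<close> is its density. The hypothesis that \<open>F\<close> is constant
  outside \<open>{a..b}\<close> makes the measure finite and concentrates it on \<open>{a..b}\<close>.\<close>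

lemma monotone_abs_continuous_eq_integral:
  assumes "a < b" and mono: "\<And>x y. x \<le> y \<Longrightarrow> F x \<le> F y" and cont: "continuous_on UNIV F"
    and left: "\<And>x. x \<le> a \<Longrightarrow> F x = F a" and right: "\<And>x. b \<le> x \<Longrightarrow> F x = F b"
    and ac: "abs_continuous_on {a..b} F"
  obtains g :: "real \<Rightarrow> real" where "integrable lborel g"
    "\<And>y z. y \<le> z \<Longrightarrow> F z - F y = (LINT s:{y..z}|lborel. g s)"
proof -
  let ?M = "interval_measure F"
  have Icc: "emeasure ?M {y..z} = ennreal (F z - F y)" if "y \<le> z" for y z
    using that mono cont by (rule emeasure_interval_measure_Icc)
  \<comment> \<open>Outside \<open>{a..b}\<close> countably many intervals of zero measure exhaust the line.\<close>
  have out: "- {a..b} \<in> null_sets ?M"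
  proof -
    have "{a - real n - 1/real (Suc n)..a - 1/real (Suc n)} \<in> null_sets ?M" for n
    proof -
      have "a - real n - 1/real (Suc n) \<le> a - 1/real (Suc n)" "a - 1/real (Suc n) \<le> a" by simp_all
      moreover from this have "a - real n - 1/real (Suc n) \<le> a" by (rule order_trans)
      ultimately show ?thesis
        using left[of "a - real n - 1/real (Suc n)"] left[of "a - 1/real (Suc n)"] Icc
        by (intro null_setsI) (simp_all del: of_nat_Suc)
    qed
    moreover have "{b + 1/real (Suc n)..b + real n + 1/real (Suc n)} \<in> null_sets ?M" for n
    proof -
      have "b + 1/real (Suc n) \<le> b + real n + 1/real (Suc n)" "b \<le> b + 1/real (Suc n)" by simp_all
      moreover from this(2,1) have "b \<le> b + real n + 1/real (Suc n)" by (rule order_trans)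
      ultimately show ?thesis
        using right[of "b + real n + 1/real (Suc n)"] right[of "b + 1/real (Suc n)"] Icc
        by (intro null_setsI) (simp_all del: of_nat_Suc)
    qed
    ultimately have "(\<Union>n. {a - real n - 1/real (Suc n)..a - 1/real (Suc n)}
        \<union> {b + 1/real (Suc n)..b + real n + 1/real (Suc n)}) \<in> null_sets ?M"
      by (intro null_sets_UN null_sets.Un)
    moreover have "- {a..b} \<subseteq> (\<Union>n. {a - real n - 1/real (Suc n)..a - 1/real (Suc n)}
        \<union> {b + 1/real (Suc n)..b + real n + 1/real (Suc n)})"
    proof
      fix x assume "x \<in> - {a..b}"
      then have pos: "max (a - x) (x - b) > 0" by auto
      obtain n1 :: nat where n1: "1 / real (Suc n1) < max (a - x) (x - b)"
        using nat_approx_posE[OF pos] by blast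
      obtain n2 :: nat where n2: "max (a - x) (x - b) \<le> real n2" using real_arch_simple by blast
      define n where "n = max n1 n2"
      have "1 / real (Suc n) \<le> 1 / real (Suc n1)" "real n2 \<le> real n"
        by (auto simp: n_def field_simps)
      then have "1 / real (Suc n) < max (a - x) (x - b)" "max (a - x) (x - b) \<le> real n + 1 / real (Suc n)"
        using n1 n2 by (linarith, smt (verit) divide_nonneg_nonneg of_nat_0_le_iff)
      then show "x \<in> (\<Union>n. {a - real n - 1/real (Suc n)..a - 1/real (Suc n)}
        \<union> {b + 1/real (Suc n)..b + real n + 1/real (Suc n)})"
        using \<open>x \<in> - {a..b}\<close> by (intro UN_I[of n]) (auto simp: max_def split: if_splits)
    qed
    ultimately show ?thesis by (intro null_sets_subset[of _ ?M "- {a..b}"]) auto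
  qed
  have "absolutely_continuous lborel ?M"
    unfolding absolutely_continuous_def
  proof
    fix N :: "real set" assume N: "N \<in> null_sets lborel"
    then have "N \<inter> {a..b} \<in> null_sets lborel" by (rule null_set_Int2) simp
    then have "N \<inter> {a..b} \<in> null_sets ?M"
      by (intro interval_measure_null_set_of_abs_continuous[OF \<open>a < b\<close> mono cont ac]) auto
    then have "(N \<inter> {a..b}) \<union> - {a..b} \<in> null_sets ?M" using out by (rule null_sets.Un)
    then show "N \<in> null_sets ?M"
      by (rule null_sets_subset) (use N in auto)
  qed
  then obtain f where f[measurable]: "f \<in> borel_measurable lborel" and dens: "density lborel f = ?M"
    using sigma_finite_measure.Radon_Nikodym[OF sigma_finite_lborel, of ?M] by auto
  have emf: "(\<integral>\<^sup>+ x. f x * indicator A x \<partial>lborel) = emeasure ?M A" if "A \<in> sets borel" for A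
    using that by (subst dens[symmetric], subst emeasure_density) auto
  have "emeasure ?M UNIV = emeasure ?M ({a..b} \<union> - {a..b})" by (simp add: Compl_partition)
  also have "\<dots> = emeasure ?M {a..b}" using out by (intro emeasure_Un_null_set) auto
  finally have "emeasure ?M UNIV < \<infinity>" using Icc \<open>a < b\<close> by simp
  then have fin: "(\<integral>\<^sup>+ x. f x \<partial>lborel) < \<infinity>" using emf[of UNIV] by simp
  have fin_AE: "AE x in lborel. f x \<noteq> \<infinity>"
    using fin by (intro nn_integral_PInf_AE) auto
  define g where "g x = enn2real (f x)" for x
  have [measurable]: "g \<in> borel_measurable lborel" unfolding g_def by measurable
  have int: "integrable lborel g"
  proof (rule integrableI_bounded)
    have "(\<integral>\<^sup>+ x. ennreal (norm (g x)) \<partial>lborel) = (\<integral>\<^sup>+ x. f x \<partial>lborel)"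
      using fin_AE by (intro nn_integral_cong_AE) (auto simp: g_def top.not_eq_extremum)
    then show "(\<integral>\<^sup>+ x. ennreal (norm (g x)) \<partial>lborel) < \<infinity>" using fin by simp
  qed measurable
  have "F z - F y = (LINT s:{y..z}|lborel. g s)" if "y \<le> z" for y z
  proof -
    have "(LINT s:{y..z}|lborel. g s) = enn2real (\<integral>\<^sup>+ x. ennreal (indicator {y..z} x * g x) \<partial>lborel)"
      unfolding set_lebesgue_integral_def real_scaleR_def
      by (rule integral_eq_nn_integral) (auto simp: g_def)
    also have "(\<integral>\<^sup>+ x. ennreal (indicator {y..z} x * g x) \<partial>lborel) = (\<integral>\<^sup>+ x. f x * indicator {y..z} x \<partial>lborel)"
      using fin_AE by (intro nn_integral_cong_AE) (auto simp: g_def top.not_eq_extremum split: split_indicator)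
    also have "\<dots> = ennreal (F z - F y)" using emf[of "{y..z}"] Icc[OF that] by simp
    finally show ?thesis using mono[OF that] by simp
  qed
  with int show thesis by (rule that)
qed

text \<open>Jordan decomposition: \<open>u\<close> is the difference of the functions \<open>variation u a\<close> and
  \<open>variation u a - u\<close>, which are monotone and absolutely continuous, so each of them has a density.\<close>

theorem abs_continuous_on_eq_integral:
  assumes "a < b" and ac: "abs_continuous_on {a..b} u"
  obtains g :: "real \<Rightarrow> real" where "integrable lborel g"
    "\<And>y z. a \<le> y \<Longrightarrow> y \<le> z \<Longrightarrow> z \<le> b \<Longrightarrow> u z - u y = (LINT s:{y..z}|lborel. g s)"
proof -
  have "a \<le> b" using \<open>a < b\<close> by simp
  have bv: "bounded_variation u a b"
    using ac \<open>a \<le> b\<close> by (rule abs_continuous_on_imp_bounded_variation)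
  \<comment> \<open>Composition with the projection \<open>c\<close> onto \<open>{a..b}\<close> extends a function by its boundary values.\<close>
  define c where "c x = max a (min b x)" for x
  have c: "a \<le> c x" "c x \<le> b" for x using \<open>a < b\<close> by (auto simp: c_def)
  have c_id: "c x = x" if "a \<le> x" "x \<le> b" for x using that by (auto simp: c_def)
  have c_mono: "c x \<le> c y" if "x \<le> y" for x y using that by (auto simp: c_def)
  have c_left: "c x = a" if "x \<le> a" for x using that \<open>a < b\<close> by (auto simp: c_def)
  have c_right: "c x = b" if "b \<le> x" for x using that \<open>a < b\<close> by (auto simp: c_def)
  have c_cont: "continuous_on UNIV c" unfolding c_def by (intro continuous_intros)
  have V_inc: "\<bar>u y - u x\<bar> \<le> variation u a y - variation u a x" if "a \<le> x" "x \<le> y" "y \<le> b" for x y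
  proof -
    have "bounded_variation u a y" using bv that by (auto intro: bounded_variation_mono)
    then show ?thesis
      using that variation_add[of u a y x] abs_diff_le_variation[of u x y] bounded_variation_mono[of u a y x y]
      by simp
  qed
  have V_ac: "abs_continuous_on {a..b} (variation u a)"
    using ac \<open>a \<le> b\<close> by (rule abs_continuous_on_variation)
  have part: "\<exists>g. integrable lborel g \<and>
      (\<forall>y z. a \<le> y \<longrightarrow> y \<le> z \<longrightarrow> z \<le> b \<longrightarrow> G z - G y = (LINT s:{y..z}|lborel. g s))"
    if ac: "abs_continuous_on {a..b} G" and mono: "\<And>x y. a \<le> x \<Longrightarrow> x \<le> y \<Longrightarrow> y \<le> b \<Longrightarrow> G x \<le> G y" for G
  proof -
    have "continuous_on UNIV (\<lambda>x. G (c x))"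
      by (rule continuous_on_compose2[OF abs_continuous_on_imp_continuous_on[OF ac] c_cont]) (use c in auto)
    moreover have "abs_continuous_on {a..b} (\<lambda>x. G (c x))"
    proof -
      have "variation_sum (\<lambda>x. G (c x)) D = variation_sum G D" if "interval_family a b D" for D
        unfolding variation_sum_def
      proof (rule sum.cong[OF refl])
        fix p assume "p \<in> D"
        then have "a \<le> fst p" "fst p < snd p" "snd p \<le> b"
          using that by (auto simp: interval_family_def)
        then show "(case p of (x, y) \<Rightarrow> \<bar>G (c y) - G (c x)\<bar>) = (case p of (x, y) \<Rightarrow> \<bar>G y - G x\<bar>)"
          using c_id[of "fst p"] c_id[of "snd p"] by (simp add: case_prod_beta)
      qed
      with ac show ?thesis unfolding abs_continuous_on_interval_iff by simp
    qed
    moreover have "G (c x) \<le> G (c y)" if "x \<le> y" for x y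
      using c c_mono[OF that] by (intro mono) auto
    ultimately obtain g where g: "integrable lborel g"
      "\<And>y z. y \<le> z \<Longrightarrow> G (c z) - G (c y) = (LINT s:{y..z}|lborel. g s)"
      using monotone_abs_continuous_eq_integral[of a b "\<lambda>x. G (c x)"] \<open>a < b\<close> c_left c_right c_id
      by (smt (verit))
    have "G z - G y = (LINT s:{y..z}|lborel. g s)" if "a \<le> y" "y \<le> z" "z \<le> b" for y z
      using g(2)[OF that(2)] c_id that by simp
    then show ?thesis using g(1) by blast
  qed
  have V_mono: "variation u a x \<le> variation u a y"
    and Vu_mono: "variation u a x - u x \<le> variation u a y - u y" if "a \<le> x" "x \<le> y" "y \<le> b" for x y
    using V_inc[OF that] by linarith+
  obtain g1 where g1: "integrable lborel g1"
    "\<And>y z. a \<le> y \<Longrightarrow> y \<le> z \<Longrightarrow> z \<le> b \<Longrightarrow> variation u a z - variation u a y = (LINT s:{y..z}|lborel. g1 s)"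
    using part[OF V_ac V_mono] by auto
  obtain g2 where g2: "integrable lborel g2"
    "\<And>y z. a \<le> y \<Longrightarrow> y \<le> z \<Longrightarrow> z \<le> b \<Longrightarrow>
       (variation u a z - u z) - (variation u a y - u y) = (LINT s:{y..z}|lborel. g2 s)"
    using part[OF abs_continuous_on_diff[OF V_ac ac] Vu_mono] by auto
  show thesis
  proof (rule that)
    show "integrable lborel (\<lambda>x. g1 x - g2 x)" using g1(1) g2(1) by simp
    show "u z - u y = (LINT s:{y..z}|lborel. g1 s - g2 s)" if "a \<le> y" "y \<le> z" "z \<le> b" for y z
    proof -
      have "(LINT s:{y..z}|lborel. g1 s - g2 s) = (LINT s:{y..z}|lborel. g1 s) - (LINT s:{y..z}|lborel. g2 s)"
        using g1(1) g2(1)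
        by (intro set_integral_diff integrable_imp_set_integrable) auto
      then show ?thesis using g1(2)[OF that] g2(2)[OF that] by simp
    qed
  qed
qed

section \<open>Differentiation of indefinite integrals\<close>

text \<open>Absolute continuity of the integral: \<open>\<bar>g\<bar>\<close> splits into a part bounded by \<open>n\<close>, which is small on small
  sets, and the excess over \<open>n\<close>, whose total integral tends to 0 by dominated convergence.\<close>

lemma set_integral_abs_small:
  fixes g :: "'a \<Rightarrow> real"
  assumes g: "integrable M g" and "e > 0"
  obtains d where "d > 0"
    "\<And>A. A \<in> sets M \<Longrightarrow> emeasure M A < ennreal d \<Longrightarrow> (LINT x:A|M. \<bar>g x\<bar>) < e"
proof -
  define h where "h n x = max (\<bar>g x\<bar> - real n) 0" for n x
  have [measurable]: "g \<in> borel_measurable M" using g by auto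
  have int_h: "integrable M (h n)" for n
    by (rule Bochner_Integration.integrable_bound[OF g]) (auto simp: h_def[abs_def])
  have "(\<lambda>n. LINT x|M. h n x) \<longlonglongrightarrow> (LINT x|M. 0)"
  proof (rule integral_dominated_convergence)
    show "integrable M (\<lambda>x. \<bar>g x\<bar>)" using g by simp
    show "AE x in M. (\<lambda>n. h n x) \<longlonglongrightarrow> 0"
    proof (rule AE_I2)
      fix x
      have "\<forall>\<^sub>F n in sequentially. h n x = 0"
        using eventually_ge_at_top[of "nat \<lceil>\<bar>g x\<bar>\<rceil>"]
        by eventually_elim (auto simp: h_def max_def)
      then show "(\<lambda>n. h n x) \<longlonglongrightarrow> 0" by (rule tendsto_eventually)
    qed
    show "AE x in M. norm (h n x) \<le> \<bar>g x\<bar>" for n by (auto simp: h_def)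
  qed (auto simp: h_def)
  then have "\<forall>\<^sub>F n in sequentially. (LINT x|M. h n x) < e/2"
    using \<open>e > 0\<close> by (intro order_tendstoD) auto
  then obtain n where n: "(LINT x|M. h n x) < e/2"
    using eventually_happens' sequentially_bot by blast
  define d where "d = e / (2 * (real n + 1))"
  show thesis
  proof (rule that)
    show "d > 0" using \<open>e > 0\<close> by (simp add: d_def)
    fix A assume A[measurable]: "A \<in> sets M" and small: "emeasure M A < ennreal d"
    then have fm: "A \<in> fmeasurable M" by (auto simp: fmeasurable_def top.not_eq_extremum[symmetric])
    have m: "measure M A < d"
      using small emeasure_eq_measure2[OF fm] by (simp add: ennreal_less_iff)
    have int_c: "integrable M (\<lambda>x. real n * indicator A x)"
      using fm by (intro integrable_mult_right integrable_real_indicator) (auto simp: fmeasurable_def)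
    have "(LINT x:A|M. \<bar>g x\<bar>) \<le> (LINT x|M. real n * indicator A x + h n x)"
      unfolding set_lebesgue_integral_def
    proof (rule integral_mono)
      show "integrable M (\<lambda>x. indicat_real A x *\<^sub>R \<bar>g x\<bar>)"
        using g by (intro integrable_mult_indicator) auto
      show "integrable M (\<lambda>x. real n * indicat_real A x + h n x)"
        using int_c int_h by simp
    qed (auto simp: h_def split: split_indicator)
    also have "\<dots> = real n * measure M A + (LINT x|M. h n x)"
      using int_c int_h fm by (simp add: fmeasurable_def)
    also have "\<dots> < e"
    proof -
      have "real n * measure M A \<le> real n * d" using m by (intro mult_left_mono) auto
      also have "\<dots> \<le> e/2" using \<open>e > 0\<close> by (simp add: d_def field_simps)
      finally show ?thesis using n by simp
    qed
    finally show "(LINT x:A|M. \<bar>g x\<bar>) < e" .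
  qed
qed

lemma set_integral_countable_Union_nonneg:
  fixes g :: "'a \<Rightarrow> real"
  assumes "countable C" "disjoint_family_on I C" "\<And>p. p \<in> C \<Longrightarrow> I p \<in> sets M"
    and g: "integrable M g" and nonneg: "\<And>p. p \<in> C \<Longrightarrow> 0 \<le> (LINT x:I p|M. g x)"
  shows "0 \<le> (LINT x:(\<Union>p\<in>C. I p)|M. g x)"
proof -
  \<comment> \<open>Finite subfamilies that exhaust \<open>C\<close>: the integral over their unions is a finite sum.\<close>
  define C' where "C' n = {p\<in>C. to_nat_on C p < n}" for n
  have fin: "finite (C' n)" for n
  proof (rule finite_imageD)
    show "finite (to_nat_on C ` C' n)"
      by (rule finite_subset[of _ "{..<n}"]) (auto simp: C'_def)
    show "inj_on (to_nat_on C) (C' n)"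
      using inj_on_to_nat_on[OF assms(1)] by (rule inj_on_subset) (auto simp: C'_def)
  qed
  have sub: "C' n \<subseteq> C" for n by (auto simp: C'_def)
  define B where "B n = (\<Union>p\<in>C' n. I p)" for n
  have B_sets: "B n \<in> sets M" for n
    unfolding B_def using fin sub assms(3) by (intro sets.finite_UN) auto
  have U: "(\<Union>n. B n) = (\<Union>p\<in>C. I p)" by (auto simp: B_def C'_def)
  have "(\<lambda>n. LINT x:B n|M. g x) \<longlonglongrightarrow> (LINT x:(\<Union>n. B n)|M. g x)"
  proof (rule set_integral_cont_up)
    show "incseq B" by (force simp: incseq_def B_def C'_def)
    show "set_integrable M (\<Union>n. B n) g"
      using g B_sets by (intro integrable_imp_set_integrable sets.countable_UN) auto
  qed (rule B_sets)
  moreover have "0 \<le> (LINT x:B n|M. g x)" for n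
  proof -
    have "(LINT x:B n|M. g x) = (\<Sum>p\<in>C' n. LINT x:I p|M. g x)"
      unfolding B_def
    proof (rule set_integral_finite_Union[OF fin])
      show "disjoint_family_on I (C' n)" using assms(2) sub by (rule disjoint_family_on_mono[rotated])
      show "I p \<in> sets M" if "p \<in> C' n" for p using assms(3) sub that by blast
      then show "set_integrable M (I p) g" if "p \<in> C' n" for p
        using g that by (intro integrable_imp_set_integrable) auto
    qed
    also have "\<dots> \<ge> 0" using nonneg sub by (intro sum_nonneg) auto
    finally show ?thesis .
  qed
  ultimately have "0 \<le> (LINT x:(\<Union>n. B n)|M. g x)"
    by (intro LIMSEQ_le_const) auto
  then show ?thesis by (simp add: U)
qed

text \<open>The core of the differentiation theorem. The intervals with nonnegative integral that lie in an open
  set \<open>U \<supseteq> E\<close> form a Vitali cover of \<open>E\<close>. A countable disjoint subfamily covers \<open>E\<close> up to a null set;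
  let \<open>W\<close> be its union. The integral over \<open>W\<close> is nonnegative, but it is at most \<open>- c\<close> times the
  measure of \<open>E\<close> plus the integral of \<open>\<bar>g\<bar>\<close> over \<open>U - E\<close>, which is as small as desired.\<close>

lemma negligible_if_negative_with_nonneg_averages:
  fixes g :: "real \<Rightarrow> real"
  assumes g: "integrable lebesgue g" and E: "E \<in> lmeasurable" and "c > 0"
    and neg: "\<And>x. x \<in> E \<Longrightarrow> g x \<le> - c"
    and avg: "\<And>x d. x \<in> E \<Longrightarrow> 0 < d \<Longrightarrow>
       \<exists>y z. y \<le> x \<and> x \<le> z \<and> y < z \<and> z - y < d \<and> 0 \<le> (LINT s:{y..z}|lebesgue. g s)"
  shows "negligible E"
proof -
  have "c * measure lebesgue E \<le> e" if "e > 0" for e :: real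
  proof -
    obtain d where "d > 0" and d: "\<And>A. A \<in> sets lebesgue \<Longrightarrow> emeasure lebesgue A < ennreal d \<Longrightarrow>
        (LINT x:A|lebesgue. \<bar>g x\<bar>) < e"
      using set_integral_abs_small[OF g \<open>e > 0\<close>] by blast
    obtain U where U: "open U" "E \<subseteq> U" "U - E \<in> lmeasurable" "emeasure lebesgue (U - E) < ennreal d"
      using sets_lebesgue_outer_open[of E d] E \<open>d > 0\<close> by (auto simp: fmeasurable_def)
    define K where "K = {(y, z). y < z \<and> {y..z} \<subseteq> U \<and> 0 \<le> (LINT s:{y..z}|lebesgue. g s)}"
    define m :: "real \<times> real \<Rightarrow> real" where "m = (\<lambda>(y, z). (y + z) / 2)"
    define r :: "real \<times> real \<Rightarrow> real" where "r = (\<lambda>(y, z). (z - y) / 2)"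
    have cball_eq: "cball (m p) (r p) = {fst p..snd p}" for p
      by (cases p) (simp add: m_def r_def cball_eq_atLeastAtMost field_simps)
    obtain C where C: "countable C" "C \<subseteq> K"
      "pairwise (\<lambda>i j. disjnt (cball (m i) (r i)) (cball (m j) (r j))) C"
      "negligible (E - (\<Union>i\<in>C. cball (m i) (r i)))"
    proof (rule Vitali_covering_theorem_cballs[of K r E m])
      show "0 < r i" if "i \<in> K" for i using that by (auto simp: K_def r_def)
      show "\<exists>i. i \<in> K \<and> x \<in> cball (m i) (r i) \<and> r i < h" if "x \<in> E" "0 < h" for x h
      proof -
        obtain k where k: "k > 0" "cball x k \<subseteq> U"
          using U(1,2) \<open>x \<in> E\<close> open_contains_cball by blast
        obtain y z where yz: "y \<le> x" "x \<le> z" "y < z" "z - y < min h k" "0 \<le> (LINT s:{y..z}|lebesgue. g s)"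
          using avg[OF \<open>x \<in> E\<close>, of "min h k"] \<open>0 < h\<close> k(1) by auto
        have "{y..z} \<subseteq> cball x k" using yz by (auto simp: dist_real_def)
        then have "(y, z) \<in> K" using k(2) yz by (auto simp: K_def)
        moreover have "r (y, z) < h" using yz by (simp add: r_def)
        ultimately show ?thesis using yz by (intro exI[of _ "(y, z)"]) (simp add: cball_eq)
      qed
    qed
    define W where "W = (\<Union>p\<in>C. {fst p..snd p})"
    have W_sets: "W \<in> sets lebesgue"
      unfolding W_def using C(1) by (intro sets.countable_UN'') auto
    have "{fst p..snd p} \<subseteq> U" if "p \<in> C" for p
      using subsetD[OF C(2) that] by (auto simp: K_def case_prod_beta)
    then have "W \<subseteq> U" unfolding W_def by blast
    have E_sets: "E \<in> sets lebesgue" using E by (simp add: fmeasurable_def)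
    have "0 \<le> (LINT x:W|lebesgue. g x)"
      unfolding W_def
    proof (rule set_integral_countable_Union_nonneg[OF C(1) _ _ g])
      show "disjoint_family_on (\<lambda>p. {fst p..snd p}) C"
        using C(3) unfolding cball_eq by (auto simp: disjoint_family_on_def pairwise_def disjnt_def)
      show "0 \<le> (LINT x:{fst p..snd p}|lebesgue. g x)" if "p \<in> C" for p
        using that C(2) by (auto simp: K_def)
    qed auto
    moreover have "(LINT x:W|lebesgue. g x) = (LINT x:(W \<inter> E) \<union> (W - E)|lebesgue. g x)"
      by (simp add: Int_Diff_Un)
    moreover have "(LINT x:(W \<inter> E) \<union> (W - E)|lebesgue. g x) = (LINT x:W \<inter> E|lebesgue. g x) + (LINT x:W - E|lebesgue. g x)"
      using g W_sets E_sets by (intro set_integral_Un integrable_imp_set_integrable) auto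
    moreover have "(LINT x:W - E|lebesgue. g x) \<le> (LINT x:U - E|lebesgue. \<bar>g x\<bar>)"
      unfolding set_lebesgue_integral_def
    proof (rule integral_mono)
      show "integrable lebesgue (\<lambda>x. indicat_real (W - E) x *\<^sub>R g x)"
        using g W_sets E_sets by (intro integrable_mult_indicator) auto
      show "integrable lebesgue (\<lambda>x. indicat_real (U - E) x *\<^sub>R \<bar>g x\<bar>)"
        using g U(3) by (intro integrable_mult_indicator integrable_abs) (auto simp: fmeasurable_def)
      show "indicat_real (W - E) x *\<^sub>R g x \<le> indicat_real (U - E) x *\<^sub>R \<bar>g x\<bar>" for x
        using \<open>W \<subseteq> U\<close> by (auto split: split_indicator)
    qed
    moreover have "(LINT x:U - E|lebesgue. \<bar>g x\<bar>) < e"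
      using d[of "U - E"] U(3,4) by (simp add: fmeasurable_def)
    moreover have "(LINT x:W \<inter> E|lebesgue. g x) \<le> - c * measure lebesgue E"
    proof -
      have WE: "W \<inter> E \<in> lmeasurable"
        using E W_sets by (intro fmeasurable_Int_fmeasurable[of E lebesgue W, unfolded Int_commute[of E]]) auto
      have "measure lebesgue (W \<inter> E) = measure lebesgue E"
      proof (rule measure_negligible_symdiff)
        have "(E - W \<inter> E) \<union> (W \<inter> E - E) = E - W" by auto
        then show "negligible ((E - W \<inter> E) \<union> (W \<inter> E - E))"
          using C(4) by (simp add: cball_eq W_def)
      qed (use WE E in auto)
      moreover have "(LINT x:W \<inter> E|lebesgue. g x) \<le> (LINT x|lebesgue. indicat_real (W \<inter> E) x * (- c))"
        unfolding set_lebesgue_integral_def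
      proof (rule integral_mono)
        show "integrable lebesgue (\<lambda>x. indicat_real (W \<inter> E) x *\<^sub>R g x)"
          using g W_sets E_sets by (intro integrable_mult_indicator) auto
        show "integrable lebesgue (\<lambda>x. indicat_real (W \<inter> E) x * (- c))"
          using WE by (intro integrable_mult_left integrable_real_indicator) (auto simp: fmeasurable_def)
      qed (use neg in \<open>auto split: split_indicator\<close>)
      ultimately show ?thesis using WE by (simp add: fmeasurable_def mult.commute)
    qed
    ultimately show ?thesis by linarith
  qed
  then have "c * measure lebesgue E \<le> 0"
    by - (rule field_le_epsilon, simp)
  then have "measure lebesgue E = 0"
    using \<open>c > 0\<close> by (simp add: mult_le_0_iff antisym)
  then show ?thesis using E by (simp add: negligible_iff_measure)
qed

text \<open>The preceding lemma for \<open>g - q\<close> on the set where \<open>g \<le> p\<close> although arbitrarily short intervals around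
  the point have a difference quotient of \<open>F\<close> above \<open>q\<close>. Quotients over intervals \<open>{y..z}\<close> with
  \<open>y < x < z\<close> are used because the points \<open>x\<close> that such a short interval surrounds form an open set,
  which makes the exceptional set measurable.\<close>

lemma AE_difference_quotient_upper:
  fixes g F :: "real \<Rightarrow> real"
  assumes g: "integrable lebesgue g"
    and F: "\<And>y z. a \<le> y \<Longrightarrow> y \<le> z \<Longrightarrow> z \<le> b \<Longrightarrow> F z - F y = (LINT s:{y..z}|lebesgue. g s)"
    and "p < q"
  shows "AE x in lebesgue. a < x \<longrightarrow> x < b \<longrightarrow> g x \<le> p \<longrightarrow>
    (\<exists>d>0. \<forall>y z. a < y \<longrightarrow> y < x \<longrightarrow> x < z \<longrightarrow> z < b \<longrightarrow> z - y < d \<longrightarrow> F z - F y \<le> q * (z - y))"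
proof -
  define Q where "Q n = {(y, z). a < y \<and> y < z \<and> z < b \<and> z - y < 1 / real (Suc n) \<and> q * (z - y) < F z - F y}" for n
  define B where "B n = (\<Union>(y, z)\<in>Q n. {y<..<z})" for n
  define E where "E = {x\<in>{a<..<b}. g x \<le> p} \<inter> (\<Inter>n. B n)"
  have gm[measurable]: "g \<in> borel_measurable lebesgue" using g by auto
  have "open (B n)" for n unfolding B_def by auto
  then have B_sets[measurable]: "B n \<in> sets lebesgue" for n
    by (simp add: borel_open)
  have "{x\<in>space lebesgue. g x \<le> p} \<in> sets lebesgue" by measurable
  then have "{a<..<b} \<inter> {x. g x \<le> p} \<in> sets lebesgue" by (intro sets.Int) simp_all
  moreover have "{a<..<b} \<inter> {x. g x \<le> p} = {x\<in>{a<..<b}. g x \<le> p}" by auto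
  moreover have "(\<Inter>n. B n) \<in> sets lebesgue" using B_sets by (intro sets.countable_INT) auto
  ultimately have E_sets: "E \<in> sets lebesgue" unfolding E_def by (metis sets.Int)
  have "E \<subseteq> {a..b}" by (auto simp: E_def)
  then have "bounded E" by (rule bounded_subset[OF bounded_closed_interval])
  with E_sets have E: "E \<in> lmeasurable" by (intro bounded_set_imp_lmeasurable)
  have h: "integrable lebesgue (\<lambda>x. indicat_real {a..b} x * (g x - q))"
  proof -
    have "integrable lebesgue (\<lambda>x. indicat_real {a..b} x *\<^sub>R g x - indicat_real {a..b} x * q)"
      using g by (intro Bochner_Integration.integrable_diff integrable_mult_indicator integrable_mult_left integrable_real_indicator)
        (auto simp: emeasure_lborel_Icc_eq)
    then show ?thesis by (simp add: right_diff_distrib)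
  qed
  have "negligible E"
  proof (rule negligible_if_negative_with_nonneg_averages[OF h E, of "q - p"])
    show "q - p > 0" using \<open>p < q\<close> by simp
    show "indicat_real {a..b} x * (g x - q) \<le> - (q - p)" if "x \<in> E" for x
      using that by (auto simp: E_def)
    show "\<exists>y z. y \<le> x \<and> x \<le> z \<and> y < z \<and> z - y < d \<and>
        0 \<le> (LINT s:{y..z}|lebesgue. indicat_real {a..b} s * (g s - q))" if "x \<in> E" "0 < d" for x d
    proof -
      obtain n where n: "1 / real (Suc n) < d" using nat_approx_posE[OF \<open>0 < d\<close>] by blast
      have "x \<in> B n" using \<open>x \<in> E\<close> by (auto simp: E_def)
      then obtain y z where yz: "(y, z) \<in> Q n" "y < x" "x < z" by (auto simp: B_def)
      then have yz': "a < y" "z < b" "z - y < d" "q * (z - y) < F z - F y" "y < z"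
        using n by (auto simp: Q_def)
      have "(LINT s:{y..z}|lebesgue. indicat_real {a..b} s * (g s - q)) = (LINT s:{y..z}|lebesgue. g s - q)"
        using yz' by (intro set_lebesgue_integral_cong) auto
      also have "\<dots> = (LINT s:{y..z}|lebesgue. g s) - (LINT s:{y..z}|lebesgue. q)"
      proof (rule set_integral_diff(2))
        show "set_integrable lebesgue {y..z} g" using g by (intro integrable_imp_set_integrable) auto
        show "set_integrable lebesgue {y..z} (\<lambda>s. q)"
          unfolding set_integrable_def by (auto simp: emeasure_lborel_Icc_eq)
      qed
      also have "\<dots> = (F z - F y) - q * (z - y)"
        using F[of y z] yz' by (simp add: set_integral_const)
      finally show ?thesis using yz yz' by (intro exI[of _ y] exI[of _ z]) auto
    qed
  qed
  then have "AE x in lebesgue. x \<notin> E"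
    by (intro AE_not_in) (simp add: negligible_iff_null_sets)
  then show ?thesis
  proof eventually_elim
    case (elim x)
    show ?case
    proof (intro impI)
      assume x: "a < x" "x < b" "g x \<le> p"
      with elim obtain n where "x \<notin> B n" by (auto simp: E_def)
      have upper: "F z - F y \<le> q * (z - y)" if "a < y" "y < x" "x < z" "z < b" "z - y < 1 / real (Suc n)" for y z
      proof (rule ccontr)
        assume "\<not> F z - F y \<le> q * (z - y)"
        then have "(y, z) \<in> Q n" using that by (simp add: Q_def)
        moreover have "x \<in> {y<..<z}" using that by simp
        ultimately have "x \<in> B n" unfolding B_def by blast
        with \<open>x \<notin> B n\<close> show False ..
      qed
      show "\<exists>d>0. \<forall>y z. a < y \<longrightarrow> y < x \<longrightarrow> x < z \<longrightarrow> z < b \<longrightarrow> z - y < d \<longrightarrow> F z - F y \<le> q * (z - y)"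
        by (intro exI[of _ "1 / real (Suc n)"] conjI allI impI upper) (simp_all del: of_nat_Suc)
    qed
  qed
qed

lemma AE_difference_quotient_le:
  fixes g F :: "real \<Rightarrow> real"
  assumes g: "integrable lebesgue g"
    and F: "\<And>y z. a \<le> y \<Longrightarrow> y \<le> z \<Longrightarrow> z \<le> b \<Longrightarrow> F z - F y = (LINT s:{y..z}|lebesgue. g s)"
  shows "AE x in lebesgue. a < x \<longrightarrow> x < b \<longrightarrow> (\<forall>e>0. \<exists>d>0. \<forall>y z. a < y \<longrightarrow> y < x \<longrightarrow> x < z \<longrightarrow> z < b \<longrightarrow>
    z - y < d \<longrightarrow> F z - F y \<le> (g x + e) * (z - y))"
proof -
  have "AE x in lebesgue. \<forall>p\<in>\<rat>. \<forall>q\<in>\<rat>. p < q \<longrightarrow> a < x \<longrightarrow> x < b \<longrightarrow> g x \<le> p \<longrightarrow>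
    (\<exists>d>0. \<forall>y z. a < y \<longrightarrow> y < x \<longrightarrow> x < z \<longrightarrow> z < b \<longrightarrow> z - y < d \<longrightarrow> F z - F y \<le> q * (z - y))"
    by (intro AE_ball_countable'[OF _ countable_rat] AE_impI AE_difference_quotient_upper[OF g F])
  then show ?thesis
  proof eventually_elim
    case (elim x)
    show ?case
    proof (intro impI allI)
      fix e :: real assume x: "a < x" "x < b" and "e > 0"
      obtain p where p: "p \<in> \<rat>" "g x < p" "p < g x + e"
        using Rats_dense_in_real[of "g x" "g x + e"] \<open>e > 0\<close> by auto
      obtain q where q: "q \<in> \<rat>" "p < q" "q < g x + e"
        using Rats_dense_in_real[of p "g x + e"] p by auto
      obtain d where d: "d > 0" "\<And>y z. a < y \<Longrightarrow> y < x \<Longrightarrow> x < z \<Longrightarrow> z < b \<Longrightarrow> z - y < d \<Longrightarrow> F z - F y \<le> q * (z - y)"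
        using elim[rule_format, OF p(1) q(1,2) x] p(2) by auto
      have "F z - F y \<le> (g x + e) * (z - y)" if "a < y" "y < x" "x < z" "z < b" "z - y < d" for y z
      proof -
        have "q * (z - y) \<le> (g x + e) * (z - y)"
          using q(3) that by (intro mult_right_mono) auto
        then show ?thesis using d(2)[OF that] by linarith
      qed
      then show "\<exists>d>0. \<forall>y z. a < y \<longrightarrow> y < x \<longrightarrow> x < z \<longrightarrow> z < b \<longrightarrow> z - y < d \<longrightarrow> F z - F y \<le> (g x + e) * (z - y)"
        using d(1) by blast
    qed
  qed
qed

text \<open>Difference quotients at \<open>x\<close> itself are limits of quotients over intervals around \<open>x\<close>: let one endpoint
  tend to \<open>x\<close> and use the continuity of \<open>F\<close>.\<close>

lemma has_real_derivative_of_straddling_quotients: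
  fixes F :: "real \<Rightarrow> real"
  assumes x: "a < x" "x < b" and cont: "continuous_on {a..b} F"
    and quot: "\<And>e. e > 0 \<Longrightarrow> \<exists>d>0. \<forall>y z. a < y \<longrightarrow> y < x \<longrightarrow> x < z \<longrightarrow> z < b \<longrightarrow> z - y < d \<longrightarrow>
      \<bar>F z - F y - l * (z - y)\<bar> \<le> e * (z - y)"
  shows "(F has_real_derivative l) (at x)"
proof -
  have tend: "(F \<longlongrightarrow> F x) (at x)"
  proof -
    have "isCont F x"
      using continuous_on_interior[OF cont, of x] x by simp
    then show ?thesis by (simp add: isCont_def)
  qed
  have "((\<lambda>y. (F y - F x) / (y - x)) \<longlongrightarrow> l) (at x)"
  proof (rule tendstoI)
    fix e :: real assume "e > 0"
    then obtain d where "d > 0" and "\<forall>y z. a < y \<longrightarrow> y < x \<longrightarrow> x < z \<longrightarrow> z < b \<longrightarrow> z - y < d \<longrightarrow>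
        \<bar>F z - F y - l * (z - y)\<bar> \<le> e/2 * (z - y)"
      using quot[of "e/2"] half_gt_zero[of e] by blast
    then have d: "\<And>y z. a < y \<Longrightarrow> y < x \<Longrightarrow> x < z \<Longrightarrow> z < b \<Longrightarrow> z - y < d \<Longrightarrow>
        \<bar>F z - F y - l * (z - y)\<bar> \<le> e/2 * (z - y)" for y z
      by blast
    have right: "\<bar>F z - F x - l * (z - x)\<bar> \<le> e/2 * (z - x)" if z: "x < z" "z < b" "z < x + d/2" for z
    proof (rule tendsto_le)
      show "((\<lambda>y. e/2 * (z - y)) \<longlongrightarrow> e/2 * (z - x)) (at_left x)"
        by (intro tendsto_intros)
      show "((\<lambda>y. \<bar>F z - F y - l * (z - y)\<bar>) \<longlongrightarrow> \<bar>F z - F x - l * (z - x)\<bar>) (at_left x)"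
        by (intro tendsto_intros tendsto_mono[OF _ tend] at_le) auto
      have "\<forall>\<^sub>F y in at_left x. y \<in> {max a (x - d/2)<..<x}"
        using x \<open>d > 0\<close> by (intro eventually_at_left_real) auto
      then show "\<forall>\<^sub>F y in at_left x. \<bar>F z - F y - l * (z - y)\<bar> \<le> e/2 * (z - y)"
        by eventually_elim (rule d, use z in auto)
    qed simp
    have left: "\<bar>F x - F y - l * (x - y)\<bar> \<le> e/2 * (x - y)" if y: "a < y" "y < x" "x - d/2 < y" for y
    proof (rule tendsto_le)
      show "((\<lambda>z. e/2 * (z - y)) \<longlongrightarrow> e/2 * (x - y)) (at_right x)"
        by (intro tendsto_intros)
      show "((\<lambda>z. \<bar>F z - F y - l * (z - y)\<bar>) \<longlongrightarrow> \<bar>F x - F y - l * (x - y)\<bar>) (at_right x)"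
        by (intro tendsto_intros tendsto_mono[OF _ tend] at_le) auto
      have "\<forall>\<^sub>F z in at_right x. z \<in> {x<..<min b (x + d/2)}"
        using x \<open>d > 0\<close> by (intro eventually_at_right_real) auto
      then show "\<forall>\<^sub>F z in at_right x. \<bar>F z - F y - l * (z - y)\<bar> \<le> e/2 * (z - y)"
        by eventually_elim (rule d, use y in auto)
    qed simp
    have close: "dist ((F y - F x) / (y - x)) l < e"
      if y: "a < y" "y < b" "y \<noteq> x" "\<bar>y - x\<bar> < d/2" for y
    proof -
      have "\<bar>F y - F x - l * (y - x)\<bar> \<le> e/2 * \<bar>y - x\<bar>"
      proof (cases "x < y")
        case True
        then show ?thesis using right[of y] y by simp
      next
        case False
        then have "\<bar>F x - F y - l * (x - y)\<bar> \<le> e/2 * (x - y)" "\<bar>y - x\<bar> = x - y"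
          using left[of y] y by auto
        moreover have "F y - F x - l * (y - x) = - (F x - F y - l * (x - y))"
          by (simp add: algebra_simps)
        then have "\<bar>F y - F x - l * (y - x)\<bar> = \<bar>F x - F y - l * (x - y)\<bar>"
          by (simp only: abs_minus_cancel)
        ultimately show ?thesis by (simp only:)
      qed
      also have "\<dots> < e * \<bar>y - x\<bar>" using \<open>e > 0\<close> y by simp
      finally have "\<bar>F y - F x - l * (y - x)\<bar> / \<bar>y - x\<bar> < e"
        using y by (simp add: divide_less_eq)
      moreover have "(F y - F x) / (y - x) - l = (F y - F x - l * (y - x)) / (y - x)"
        using y by (simp add: field_simps)
      ultimately show ?thesis by (simp add: dist_real_def)
    qed
    have "\<forall>\<^sub>F y in at x. y \<in> {max a (x - d/2)<..<min b (x + d/2)}"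
      using x \<open>d > 0\<close> by (intro eventually_at_in_open') auto
    moreover have "\<forall>\<^sub>F y in at x. y \<noteq> x"
      by (simp add: eventually_at_filter)
    ultimately show "\<forall>\<^sub>F y in at x. dist ((F y - F x) / (y - x)) l < e"
      by eventually_elim (rule close, auto simp: abs_if)
  qed
  then show ?thesis by (simp add: has_field_derivative_iff)
qed

text \<open>The upper estimate applied to \<open>g, F\<close> and to \<open>- g, - F\<close> bounds the difference quotients from both sides.\<close>

theorem lebesgue_differentiation:
  fixes g F :: "real \<Rightarrow> real"
  assumes g: "integrable lebesgue g"
    and F: "\<And>y z. a \<le> y \<Longrightarrow> y \<le> z \<Longrightarrow> z \<le> b \<Longrightarrow> F z - F y = (LINT s:{y..z}|lebesgue. g s)"
    and cont: "continuous_on {a..b} F"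
  shows "AE x in lebesgue. a < x \<longrightarrow> x < b \<longrightarrow> (F has_real_derivative g x) (at x)"
proof -
  have upper: "AE x in lebesgue. a < x \<longrightarrow> x < b \<longrightarrow> (\<forall>e>0. \<exists>d>0. \<forall>y z. a < y \<longrightarrow> y < x \<longrightarrow> x < z \<longrightarrow> z < b \<longrightarrow>
    z - y < d \<longrightarrow> F z - F y \<le> (g x + e) * (z - y))"
    using g F by (rule AE_difference_quotient_le)
  have "- F z - - F y = (LINT s:{y..z}|lebesgue. - g s)" if "a \<le> y" "y \<le> z" "z \<le> b" for y z
    using F[OF that] g by (subst set_integral_uminus) (auto intro: integrable_imp_set_integrable)
  then have lower: "AE x in lebesgue. a < x \<longrightarrow> x < b \<longrightarrow> (\<forall>e>0. \<exists>d>0. \<forall>y z. a < y \<longrightarrow> y < x \<longrightarrow> x < z \<longrightarrow> z < b \<longrightarrow>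
    z - y < d \<longrightarrow> - F z - - F y \<le> (- g x + e) * (z - y))"
    using g by (intro AE_difference_quotient_le) auto
  from upper lower show ?thesis
  proof eventually_elim
    case (elim x)
    show ?case
    proof (intro impI)
      assume x: "a < x" "x < b"
      show "(F has_real_derivative g x) (at x)"
      proof (rule has_real_derivative_of_straddling_quotients[OF x cont])
        fix e :: real assume "e > 0"
        obtain d1 where d1: "d1 > 0" "\<And>y z. a < y \<Longrightarrow> y < x \<Longrightarrow> x < z \<Longrightarrow> z < b \<Longrightarrow> z - y < d1 \<Longrightarrow>
            F z - F y \<le> (g x + e) * (z - y)"
          using elim(1) x \<open>e > 0\<close> by meson
        obtain d2 where d2: "d2 > 0" "\<And>y z. a < y \<Longrightarrow> y < x \<Longrightarrow> x < z \<Longrightarrow> z < b \<Longrightarrow> z - y < d2 \<Longrightarrow>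
            - F z - - F y \<le> (- g x + e) * (z - y)"
          using elim(2) x \<open>e > 0\<close> by meson
        have "\<bar>F z - F y - g x * (z - y)\<bar> \<le> e * (z - y)"
          if "a < y" "y < x" "x < z" "z < b" "z - y < min d1 d2" for y z
          using d1(2)[of y z] d2(2)[of y z] that by (auto simp: algebra_simps abs_le_iff)
        then show "\<exists>d>0. \<forall>y z. a < y \<longrightarrow> y < x \<longrightarrow> x < z \<longrightarrow> z < b \<longrightarrow> z - y < d \<longrightarrow>
            \<bar>F z - F y - g x * (z - y)\<bar> \<le> e * (z - y)"
          using d1(1) d2(1) by (intro exI[of _ "min d1 d2"]) auto
      qed
    qed
  qed
qed

text \<open>The density \<open>g\<close> is a Borel version of the derivative of \<open>u\<close>; it is the function with which the
  Caputo integrals are computed below.\<close>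

theorem abs_continuous_on_fundamental_theorem:
  assumes "a < b" and ac: "abs_continuous_on {a..b} u"
  obtains g :: "real \<Rightarrow> real" where "integrable lborel g"
    "AE s in lebesgue. a < s \<longrightarrow> s < b \<longrightarrow> deriv u s = g s"
    "\<And>y z. a \<le> y \<Longrightarrow> y \<le> z \<Longrightarrow> z \<le> b \<Longrightarrow> u z - u y = (LINT s:{y..z}|lebesgue. g s)"
proof -
  obtain g where g: "integrable lborel g"
    "\<And>y z. a \<le> y \<Longrightarrow> y \<le> z \<Longrightarrow> z \<le> b \<Longrightarrow> u z - u y = (LINT s:{y..z}|lborel. g s)"
    using abs_continuous_on_eq_integral[OF assms] by blast
  have [measurable]: "g \<in> borel_measurable borel" using g(1) by auto
  have g_leb: "integrable lebesgue g"
    using g(1) by (simp add: integrable_completion)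
  have int: "u z - u y = (LINT s:{y..z}|lebesgue. g s)" if "a \<le> y" "y \<le> z" "z \<le> b" for y z
  proof -
    have "(LINT s:{y..z}|lebesgue. g s) = (LINT s:{y..z}|lborel. g s)"
      unfolding set_lebesgue_integral_def by (rule integral_completion) measurable
    then show ?thesis using g(2)[OF that] by simp
  qed
  have "AE x in lebesgue. a < x \<longrightarrow> x < b \<longrightarrow> (u has_real_derivative g x) (at x)"
    using g_leb int abs_continuous_on_imp_continuous_on[OF ac] by (rule lebesgue_differentiation)
  then have "AE x in lebesgue. a < x \<longrightarrow> x < b \<longrightarrow> deriv u x = g x"
    by eventually_elim (auto intro: DERIV_imp_deriv)
  with g(1) show thesis using int by (rule that)
qed

section \<open>Functions annihilated by power kernels\<close>

lemma set_integrable_continuous_mult: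
  fixes f h :: "real \<Rightarrow> real"
  assumes f: "integrable lebesgue f" and h: "continuous_on {a..b} h"
  shows "set_integrable lebesgue {a..b} (\<lambda>s. h s * f s)"
proof -
  have "bounded (h ` {a..b})"
    by (rule compact_imp_bounded[OF compact_continuous_image[OF h compact_Icc]])
  then obtain B where "\<forall>s\<in>{a..b}. \<bar>h s\<bar> \<le> B"
    by (auto simp: bounded_iff)
  then have B: "\<bar>h s\<bar> \<le> B" if "s \<in> {a..b}" for s using that by blast
  have [measurable]: "f \<in> borel_measurable lebesgue" using f by auto
  have "(\<lambda>s. indicat_real {a..b} s *\<^sub>R h s) \<in> borel_measurable borel"
    using h by (intro borel_measurable_continuous_on_indicator) auto
  then have [measurable]: "(\<lambda>s. indicat_real {a..b} s *\<^sub>R h s) \<in> borel_measurable lebesgue"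
    using measurable_completion by (metis measurable_lborel2)
  have "integrable lebesgue (\<lambda>s. (indicat_real {a..b} s *\<^sub>R h s) * f s)"
  proof (rule Bochner_Integration.integrable_bound)
    show "integrable lebesgue (\<lambda>s. B * f s)" using f by simp
    show "AE s in lebesgue. norm ((indicat_real {a..b} s *\<^sub>R h s) * f s) \<le> norm (B * f s)"
    proof (rule AE_I2)
      fix s
      show "norm ((indicat_real {a..b} s *\<^sub>R h s) * f s) \<le> norm (B * f s)"
      proof (cases "s \<in> {a..b}")
        case True
        then have "\<bar>h s\<bar> * \<bar>f s\<bar> \<le> \<bar>B\<bar> * \<bar>f s\<bar>"
          using B[OF True] by (intro mult_right_mono) auto
        then show ?thesis using True by (simp add: abs_mult)
      qed simp
    qed
  qed measurable
  then show ?thesis unfolding set_integrable_def by (simp add: mult.assoc)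
qed

lemma powr_kernel_continuous_on:
  fixes a b t p :: real
  shows "b < t \<Longrightarrow> continuous_on {a..b} (\<lambda>s. (t - s) powr p)"
  by (intro continuous_intros) auto

text \<open>Differentiation in \<open>t\<close> under the integral: the difference quotients \<open>q n\<close> of the kernel are bounded
  uniformly for \<open>s \<le> b\<close> by the mean value theorem, because \<open>t\<close> stays away from \<open>b\<close>.\<close>

lemma powr_kernel_integral_zero_deriv:
  fixes f :: "real \<Rightarrow> real"
  assumes f: "integrable lebesgue f" and "p < 0"
    and zero: "\<And>t. b < t \<Longrightarrow> t < c \<Longrightarrow> (LINT s:{a..b}|lebesgue. (t - s) powr p * f s) = 0"
    and t: "b < t" "t < c"
  shows "(LINT s:{a..b}|lebesgue. (t - s) powr (p - 1) * f s) = 0"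
proof -
  \<comment> \<open>Step sizes that keep \<open>t + h n\<close> below \<open>c\<close>.\<close>
  define h where "h n = (c - t) * inverse (real (Suc (Suc n)))" for n
  have h_pos: "h n > 0" and h_less: "t + h n < c" for n
  proof -
    show "h n > 0" using t by (simp add: h_def del: of_nat_Suc)
    have "inverse (real (Suc (Suc n))) < 1" by (simp add: inverse_less_1_iff)
    then have "h n < (c - t) * 1" unfolding h_def using t by (intro mult_strict_left_mono) auto
    then show "t + h n < c" by simp
  qed
  have h_lim: "h \<longlonglongrightarrow> 0" 
    unfolding h_def by (intro tendsto_mult_right_zero LIMSEQ_Suc[OF LIMSEQ_inverse_real_of_nat])
  have deriv: "((\<lambda>r. r powr p) has_real_derivative p * r powr (p - 1)) (at r)" if "r > 0" for r
    using that by (auto intro!: derivative_eq_intros simp: powr_diff)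
  define q where "q n s = ((t + h n - s) powr p - (t - s) powr p) / h n" for n s
  have q_bound: "\<bar>q n s\<bar> \<le> \<bar>p\<bar> * (t - b) powr (p - 1)" if "s \<le> b" for n s
  proof -
    have "\<exists>r. t - s < r \<and> r < t + h n - s \<and>
        (t + h n - s) powr p - (t - s) powr p = ((t + h n - s) - (t - s)) * (p * r powr (p - 1))"
      using h_pos[of n] that t by (intro MVT2 deriv) auto
    then obtain r where r: "t - s < r" "(t + h n - s) powr p - (t - s) powr p = h n * (p * r powr (p - 1))"
      by auto
    then have "\<bar>q n s\<bar> = \<bar>p\<bar> * r powr (p - 1)"
      using h_pos[of n] by (simp add: q_def abs_mult)
    also have "\<dots> \<le> \<bar>p\<bar> * (t - b) powr (p - 1)"
      using r(1) that t \<open>p < 0\<close> by (intro mult_left_mono powr_mono2') auto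
    finally show ?thesis .
  qed
  have q_lim: "(\<lambda>n. q n s) \<longlonglongrightarrow> p * (t - s) powr (p - 1)" if "s \<le> b" for s
  proof -
    have "((\<lambda>k. ((t - s + k) powr p - (t - s) powr p) / k) \<longlongrightarrow> p * (t - s) powr (p - 1)) (at 0)"
      using deriv[of "t - s"] that t by (simp add: DERIV_def)
    moreover have "filterlim h (at 0) sequentially"
      using h_lim h_pos by (auto simp: filterlim_at less_imp_neq[symmetric])
    ultimately have "(\<lambda>n. ((t - s + h n) powr p - (t - s) powr p) / h n) \<longlonglongrightarrow> p * (t - s) powr (p - 1)"
      by (rule filterlim_compose)
    then show ?thesis by (simp add: q_def algebra_simps)
  qed
  have int: "set_integrable lebesgue {a..b} (\<lambda>s. (t' - s) powr r * f s)" if "b < t'" for t' r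
    using f that by (intro set_integrable_continuous_mult powr_kernel_continuous_on)
  have q_int: "set_integrable lebesgue {a..b} (\<lambda>s. q n s * f s)" for n
    unfolding q_def using f t h_pos[of n]
    by (intro set_integrable_continuous_mult continuous_intros) auto
  have q_zero: "(LINT s:{a..b}|lebesgue. q n s * f s) = 0" for n
  proof -
    have "(LINT s:{a..b}|lebesgue. q n s * f s) =
        (LINT s:{a..b}|lebesgue. ((t + h n - s) powr p * f s - (t - s) powr p * f s) / h n)"
      by (simp add: q_def algebra_simps)
    also have "\<dots> = ((LINT s:{a..b}|lebesgue. (t + h n - s) powr p * f s) -
        (LINT s:{a..b}|lebesgue. (t - s) powr p * f s)) / h n"
      using int[of "t + h n" p] int[of t p] h_pos[of n] t by (simp add: set_integral_diff(2))
    also have "\<dots> = 0"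
      using zero[of "t + h n"] zero[of t] h_pos[of n] h_less[of n] t by simp
    finally show ?thesis .
  qed
  have "(\<lambda>n. LINT s|lebesgue. indicat_real {a..b} s *\<^sub>R (q n s * f s)) \<longlonglongrightarrow>
      (LINT s|lebesgue. indicat_real {a..b} s *\<^sub>R (p * ((t - s) powr (p - 1) * f s)))"
  proof (rule integral_dominated_convergence)
    show "(\<lambda>s. indicat_real {a..b} s *\<^sub>R (p * ((t - s) powr (p - 1) * f s))) \<in> borel_measurable lebesgue"
      using set_integrable_mult_right[OF int[of t "p - 1"], of p] t by (auto simp: set_integrable_def)
    show "(\<lambda>s. indicat_real {a..b} s *\<^sub>R (q n s * f s)) \<in> borel_measurable lebesgue" for n
      using q_int[of n] by (auto simp: set_integrable_def)
    show "integrable lebesgue (\<lambda>s. (\<bar>p\<bar> * (t - b) powr (p - 1)) * \<bar>f s\<bar>)" using f by simp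
    show "AE s in lebesgue. (\<lambda>n. indicat_real {a..b} s *\<^sub>R (q n s * f s)) \<longlonglongrightarrow>
        indicat_real {a..b} s *\<^sub>R (p * ((t - s) powr (p - 1) * f s))"
    proof (rule AE_I2)
      fix s
      show "(\<lambda>n. indicat_real {a..b} s *\<^sub>R (q n s * f s)) \<longlonglongrightarrow>
        indicat_real {a..b} s *\<^sub>R (p * ((t - s) powr (p - 1) * f s))"
        using tendsto_mult_right[OF q_lim[of s], of "f s"] by (cases "s \<in> {a..b}") (auto simp: mult.assoc)
    qed
    show "AE s in lebesgue. norm (indicat_real {a..b} s *\<^sub>R (q n s * f s)) \<le> (\<bar>p\<bar> * (t - b) powr (p - 1)) * \<bar>f s\<bar>" for n
    proof (rule AE_I2)
      fix s
      show "norm (indicat_real {a..b} s *\<^sub>R (q n s * f s)) \<le> (\<bar>p\<bar> * (t - b) powr (p - 1)) * \<bar>f s\<bar>"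
        using mult_right_mono[OF q_bound[of s n], of "\<bar>f s\<bar>"] by (cases "s \<in> {a..b}") (auto simp: abs_mult)
    qed
  qed
  then have "(\<lambda>n. LINT s:{a..b}|lebesgue. q n s * f s) \<longlonglongrightarrow>
      (LINT s:{a..b}|lebesgue. p * ((t - s) powr (p - 1) * f s))"
    by (simp only: set_lebesgue_integral_def)
  then have "(LINT s:{a..b}|lebesgue. p * ((t - s) powr (p - 1) * f s)) = 0"
    unfolding q_zero using LIMSEQ_unique tendsto_const by blast
  then show ?thesis using \<open>p < 0\<close> by simp
qed

lemma powr_kernel_integral_zero_all_orders:
  fixes f :: "real \<Rightarrow> real"
  assumes f: "integrable lebesgue f" and "p < 0"
    and zero: "\<And>t. b < t \<Longrightarrow> t < c \<Longrightarrow> (LINT s:{a..b}|lebesgue. (t - s) powr p * f s) = 0"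
    and t: "b < t" "t < c"
  shows "(LINT s:{a..b}|lebesgue. (t - s) powr (p - real k) * f s) = 0"
  using t
proof (induction k arbitrary: t)
  case 0
  then show ?case using zero by simp
next
  case (Suc k)
  have "(LINT s:{a..b}|lebesgue. (t - s) powr (p - real k - 1) * f s) = 0"
    using f _ Suc.IH Suc.prems by (rule powr_kernel_integral_zero_deriv) (use \<open>p < 0\<close> in auto)
  then show ?case by (simp add: algebra_simps)
qed

text \<open>The kernels \<open>(t - s) powr (p - k)\<close> are \<open>(t - s) powr p\<close> times the powers of \<open>x = 1 / (t - s)\<close>, and
  \<open>s \<mapsto> x\<close> is a homeomorphism of \<open>{a..b}\<close> onto a compact interval. In the variable \<open>x\<close> the Weierstrass
  theorem approximates \<open>h s / (t - s) powr p\<close> uniformly by polynomials, whose integrals vanish.\<close>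

lemma continuous_test_integral_zero:
  fixes f h :: "real \<Rightarrow> real"
  assumes f: "integrable lebesgue f" and "b < t"
    and zero: "\<And>k. (LINT s:{a..b}|lebesgue. (t - s) powr (p - real k) * f s) = 0"
    and h: "continuous_on {a..b} h"
  shows "(LINT s:{a..b}|lebesgue. h s * f s) = 0"
proof (cases "a \<le> b")
  case False
  then show ?thesis by (simp add: set_lebesgue_integral_def)
next
  case True
  obtain M where M: "M > 0" "\<And>s. s \<in> {a..b} \<Longrightarrow> (t - s) powr p \<le> M"
  proof -
    have "bounded ((\<lambda>s. (t - s) powr p) ` {a..b})"
      using \<open>b < t\<close> by (intro compact_imp_bounded compact_continuous_image powr_kernel_continuous_on) auto
    then obtain B where B: "\<forall>s\<in>{a..b}. \<bar>(t - s) powr p\<bar> \<le> B" by (auto simp: bounded_iff)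
    show thesis
    proof (rule that[of "max B 1"])
      show "(t - s) powr p \<le> max B 1" if "s \<in> {a..b}" for s
        using B that by (force simp: le_max_iff_disj)
    qed simp
  qed
  \<comment> \<open>The function \<open>h s / (t - s) powr p\<close> in the variable \<open>x = 1 / (t - s)\<close>.\<close>
  define q where "q x = h (t - 1 / x) * (1 / x) powr (- p)" for x
  have q_cont: "continuous_on {1 / (t - a)..1 / (t - b)} q"
    unfolding q_def
  proof (intro continuous_intros continuous_on_compose2[OF h])
    show "(\<lambda>x. t - 1 / x) ` {1 / (t - a)..1 / (t - b)} \<subseteq> {a..b}"
    proof (rule image_subsetI)
      fix x assume x: "x \<in> {1 / (t - a)..1 / (t - b)}"
      have "0 < 1 / (t - a)" using True \<open>b < t\<close> by simp
      with x have "x > 0" by (meson atLeastAtMost_iff less_le_trans)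
      then have "1 / x \<le> t - a" "t - b \<le> 1 / x"
        using x True \<open>b < t\<close> by (auto simp: field_simps)
      then show "t - 1 / x \<in> {a..b}" by simp
    qed
  qed (use True \<open>b < t\<close> in \<open>auto simp: field_simps\<close>)
  have q_eq: "h s = (t - s) powr p * q (1 / (t - s))" if "s \<in> {a..b}" for s
    using that \<open>b < t\<close> by (simp add: q_def powr_minus)
  have bound: "\<bar>LINT s:{a..b}|lebesgue. h s * f s\<bar> \<le> e * (M * (LINT s|lebesgue. \<bar>f s\<bar>))" if "e > 0" for e
  proof -
    obtain P where P: "real_polynomial_function P"
        "\<And>x. x \<in> {1 / (t - a)..1 / (t - b)} \<Longrightarrow> \<bar>q x - P x\<bar> < e"
      using Stone_Weierstrass_real_polynomial_function[OF compact_Icc q_cont \<open>e > 0\<close>] by blast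
    obtain c n where c: "P = (\<lambda>x. \<Sum>i\<le>n. c i * x ^ i)"
      using P(1) real_polynomial_function_iff_sum by auto
    have P_eq: "(t - s) powr p * P (1 / (t - s)) * f s = (\<Sum>i\<le>n. c i * ((t - s) powr (p - real i) * f s))"
      if "s \<in> {a..b}" for s
    proof -
      have "(t - s) powr (p - real i) = (t - s) powr p * (1 / (t - s)) ^ i" for i
        using that \<open>b < t\<close> by (simp add: powr_diff powr_realpow power_divide)
      then show ?thesis by (simp add: c sum_distrib_left sum_distrib_right mult_ac)
    qed
    have int: "set_integrable lebesgue {a..b} (\<lambda>s. (t - s) powr r * f s)" for r
      using f \<open>b < t\<close> by (intro set_integrable_continuous_mult powr_kernel_continuous_on)
    have "(LINT s:{a..b}|lebesgue. (t - s) powr p * P (1 / (t - s)) * f s) =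
        (LINT s:{a..b}|lebesgue. (\<Sum>i\<le>n. c i * ((t - s) powr (p - real i) * f s)))"
      using P_eq by (intro set_lebesgue_integral_cong) auto
    also have "\<dots> = (\<Sum>i\<le>n. LINT s:{a..b}|lebesgue. c i * ((t - s) powr (p - real i) * f s))"
      using int unfolding set_lebesgue_integral_def set_integrable_def
      by (simp add: sum_distrib_left Bochner_Integration.integral_sum mult.left_commute[of "indicat_real {a..b} _"])
    also have "\<dots> = 0" by (simp add: zero)
    finally have P_zero: "(LINT s:{a..b}|lebesgue. (t - s) powr p * P (1 / (t - s)) * f s) = 0" .
    have P_int: "set_integrable lebesgue {a..b} (\<lambda>s. (t - s) powr p * P (1 / (t - s)) * f s)"
      unfolding c using f \<open>b < t\<close> by (intro set_integrable_continuous_mult continuous_intros) auto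
    have h_int: "set_integrable lebesgue {a..b} (\<lambda>s. h s * f s)"
      using f h by (rule set_integrable_continuous_mult)
    have "(LINT s:{a..b}|lebesgue. h s * f s) =
        (LINT s:{a..b}|lebesgue. h s * f s - (t - s) powr p * P (1 / (t - s)) * f s)"
      using set_integral_diff(2)[OF h_int P_int] P_zero by simp
    also have "\<bar>\<dots>\<bar> \<le> (LINT s|lebesgue. (e * M) * \<bar>f s\<bar>)"
      unfolding set_lebesgue_integral_def
    proof (rule integral_abs_bound_integral)
      show "integrable lebesgue (\<lambda>s. indicat_real {a..b} s *\<^sub>R (h s * f s - (t - s) powr p * P (1 / (t - s)) * f s))"
        using set_integral_diff(1)[OF h_int P_int] by (simp add: set_integrable_def)
      show "integrable lebesgue (\<lambda>s. (e * M) * \<bar>f s\<bar>)" using f by simp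
      fix s
      show "\<bar>indicat_real {a..b} s *\<^sub>R (h s * f s - (t - s) powr p * P (1 / (t - s)) * f s)\<bar> \<le> (e * M) * \<bar>f s\<bar>"
      proof (cases "s \<in> {a..b}")
        case True
        have x: "1 / (t - s) \<in> {1 / (t - a)..1 / (t - b)}"
          using True \<open>b < t\<close> by (auto intro!: divide_left_mono)
        have "h s * f s - (t - s) powr p * P (1 / (t - s)) * f s
            = (q (1 / (t - s)) - P (1 / (t - s))) * (t - s) powr p * f s"
          using q_eq[OF True] by (simp add: algebra_simps)
        moreover have "\<bar>(q (1 / (t - s)) - P (1 / (t - s))) * (t - s) powr p * f s\<bar> \<le> e * M * \<bar>f s\<bar>"
          unfolding abs_mult using P(2)[OF x] M(2)[OF True] \<open>e > 0\<close> M(1)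
          by (intro mult_right_mono mult_mono) auto
        ultimately show ?thesis using True by simp
      qed (use \<open>e > 0\<close> M(1) in auto)
    qed
    finally show ?thesis by (simp add: mult.assoc)
  qed
  have "((\<lambda>e. e * (M * (LINT s|lebesgue. \<bar>f s\<bar>))) \<longlongrightarrow> 0 * (M * (LINT s|lebesgue. \<bar>f s\<bar>))) (at_right 0)"
    by (intro tendsto_intros)
  moreover have "\<forall>\<^sub>F e in at_right 0. \<bar>LINT s:{a..b}|lebesgue. h s * f s\<bar> \<le> e * (M * (LINT s|lebesgue. \<bar>f s\<bar>))"
    using eventually_at_right_less[of 0] by eventually_elim (rule bound)
  ultimately have "\<bar>LINT s:{a..b}|lebesgue. h s * f s\<bar> \<le> 0 * (M * (LINT s|lebesgue. \<bar>f s\<bar>))"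
    by (intro tendsto_lowerbound) auto
  then show ?thesis by simp
qed

text \<open>All continuous test functions annihilate \<open>f\<close>; the ramps \<open>r n\<close> converge to the indicator function of
  \<open>{..x}\<close>. A single order of the kernel suffices because \<open>t\<close> varies in an interval: the derivatives in
  \<open>t\<close> supply the other orders.\<close>

theorem powr_kernel_integral_zero_imp_integral_zero:
  fixes f :: "real \<Rightarrow> real"
  assumes f: "integrable lebesgue f" and "p < 0" and "b < c"
    and zero: "\<And>t. b < t \<Longrightarrow> t < c \<Longrightarrow> (LINT s:{a..b}|lebesgue. (t - s) powr p * f s) = 0"
    and x: "x \<le> b"
  shows "(LINT s:{a..x}|lebesgue. f s) = 0"
proof -
  obtain t where t: "b < t" "t < c" using dense[OF \<open>b < c\<close>] by blast
  have test: "(LINT s:{a..b}|lebesgue. h s * f s) = 0" if "continuous_on {a..b} h" for h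
    using f t(1) powr_kernel_integral_zero_all_orders[OF f \<open>p < 0\<close> zero t] that
    by (rule continuous_test_integral_zero)
  define r where "r n s = min 1 (max 0 (1 - real n * (s - x)))" for n :: nat and s
  have "(\<lambda>n. LINT s|lebesgue. indicat_real {a..b} s *\<^sub>R (r n s * f s)) \<longlonglongrightarrow>
      (LINT s|lebesgue. indicat_real {a..x} s *\<^sub>R f s)"
  proof (rule integral_dominated_convergence)
    show "(\<lambda>s. indicat_real {a..x} s *\<^sub>R f s) \<in> borel_measurable lebesgue"
      using f by (intro borel_measurable_integrable integrable_mult_indicator) auto
    have "continuous_on {a..b} (r n)" for n unfolding r_def by (intro continuous_intros)
    then show "(\<lambda>s. indicat_real {a..b} s *\<^sub>R (r n s * f s)) \<in> borel_measurable lebesgue" for n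
      using set_integrable_continuous_mult[OF f, of a b "r n"] by (auto simp: set_integrable_def)
    show "integrable lebesgue (\<lambda>s. \<bar>f s\<bar>)" using f by simp
    show "AE s in lebesgue. (\<lambda>n. indicat_real {a..b} s *\<^sub>R (r n s * f s)) \<longlonglongrightarrow> indicat_real {a..x} s *\<^sub>R f s"
    proof (rule AE_I2)
      fix s
      have "\<forall>\<^sub>F n in sequentially. r n s = indicat_real {..x} s"
      proof (cases "s \<le> x")
        case True
        have "r n s = 1" for n
        proof -
          have "real n * (s - x) \<le> 0" using True by (simp add: mult_nonneg_nonpos)
          then show ?thesis by (simp add: r_def)
        qed
        then show ?thesis using True by simp
      next
        case False
        show ?thesis
          using eventually_ge_at_top[of "nat \<lceil>1 / (s - x)\<rceil>"]
        proof eventually_elim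
          case (elim n)
          then have "1 / (s - x) \<le> real n" by linarith
          then have "1 \<le> real n * (s - x)" using False by (simp add: field_simps)
          then show ?case using False by (simp add: r_def)
        qed
      qed
      then have "\<forall>\<^sub>F n in sequentially. indicat_real {a..b} s *\<^sub>R (r n s * f s) = indicat_real {a..x} s *\<^sub>R f s"
        by eventually_elim (use x in \<open>auto split: split_indicator\<close>)
      then show "(\<lambda>n. indicat_real {a..b} s *\<^sub>R (r n s * f s)) \<longlonglongrightarrow> indicat_real {a..x} s *\<^sub>R f s"
        by (rule tendsto_eventually)
    qed
    show "AE s in lebesgue. norm (indicat_real {a..b} s *\<^sub>R (r n s * f s)) \<le> \<bar>f s\<bar>" for n
      by (intro AE_I2) (auto simp: r_def abs_mult split: split_indicator intro!: mult_left_le_one_le)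
  qed
  moreover have "continuous_on {a..b} (r n)" for n unfolding r_def by (intro continuous_intros)
  then have "(LINT s|lebesgue. indicat_real {a..b} s *\<^sub>R (r n s * f s)) = 0" for n
    using test by (simp add: set_lebesgue_integral_def)
  ultimately have "(\<lambda>n. 0) \<longlonglongrightarrow> (LINT s|lebesgue. indicat_real {a..x} s *\<^sub>R f s)"
    by (simp only:)
  then show ?thesis
    unfolding set_lebesgue_integral_def using LIMSEQ_unique tendsto_const by blast
qed

section \<open>Caputo derivatives of periodic functions\<close>

text \<open>Tonelli's theorem: the convolution of the absolute values has a finite integral.\<close>

lemma AE_integrable_convolution:
  fixes k g :: "real \<Rightarrow> real"
  assumes k: "integrable lborel k" and g: "integrable lborel g"
  shows "AE t in lborel. integrable lborel (\<lambda>s. k (t - s) * g s)"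
proof -
  have [measurable]: "k \<in> borel_measurable borel" "g \<in> borel_measurable borel" using k g by auto
  have shift: "(\<integral>\<^sup>+ t. ennreal \<bar>k (t - s)\<bar> \<partial>lborel) = (\<integral>\<^sup>+ t. ennreal \<bar>k t\<bar> \<partial>lborel)" for s
    using nn_integral_real_affine[of "\<lambda>t. ennreal \<bar>k t\<bar>" 1 "- s"] by simp
  have "(\<integral>\<^sup>+ t. (\<integral>\<^sup>+ s. ennreal \<bar>k (t - s)\<bar> * ennreal \<bar>g s\<bar> \<partial>lborel) \<partial>lborel) =
      (\<integral>\<^sup>+ s. (\<integral>\<^sup>+ t. ennreal \<bar>k (t - s)\<bar> * ennreal \<bar>g s\<bar> \<partial>lborel) \<partial>lborel)"
    by (rule lborel_pair.Fubini') measurable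
  also have "\<dots> = (\<integral>\<^sup>+ s. (\<integral>\<^sup>+ t. ennreal \<bar>k t\<bar> \<partial>lborel) * ennreal \<bar>g s\<bar> \<partial>lborel)"
    by (simp add: nn_integral_multc shift)
  also have "\<dots> = (\<integral>\<^sup>+ t. ennreal \<bar>k t\<bar> \<partial>lborel) * (\<integral>\<^sup>+ s. ennreal \<bar>g s\<bar> \<partial>lborel)"
    by (simp add: nn_integral_cmult)
  also have "\<dots> < \<infinity>"
    using k g by (simp add: integrable_iff_bounded ennreal_mult_less_top)
  finally have "AE t in lborel. (\<integral>\<^sup>+ s. ennreal \<bar>k (t - s)\<bar> * ennreal \<bar>g s\<bar> \<partial>lborel) \<noteq> \<infinity>"
    by (intro nn_integral_PInf_AE) auto
  then show ?thesis
  proof eventually_elim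
    case (elim t)
    then have "(\<integral>\<^sup>+ s. ennreal (norm (k (t - s) * g s)) \<partial>lborel) < \<infinity>"
      by (simp add: abs_mult ennreal_mult top.not_eq_extremum)
    then show ?case by (intro integrableI_bounded) auto
  qed
qed

text \<open>The Caputo integrand is integrable for almost every \<open>t\<close>, since the truncated kernel \<open>k\<close> is integrable.
  This allows the Caputo integral at \<open>t + T\<close> to be split at time 0 once it has been shifted by \<open>T\<close>.\<close>

lemma AE_integrable_powr_kernel:
  fixes g :: "real \<Rightarrow> real"
  assumes g: "integrable lborel g" and "p > - 1" "L \<ge> 0"
  shows "AE t in lebesgue. t \<le> L \<longrightarrow> set_integrable lebesgue {0..t} (\<lambda>s. (t - s) powr p * g s)"
proof -
  have [measurable]: "g \<in> borel_measurable borel" using g by auto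
  define k where "k x = indicat_real {0..L} x *\<^sub>R x powr p" for x
  have "(\<lambda>x. x powr p) integrable_on {0..L}"
    using assms by (intro integrable_on_powr_from_0)
  then have "set_integrable lebesgue {0..L} (\<lambda>x. x powr p)"
    by (intro nonnegative_absolutely_integrable_1) auto
  then have "integrable lebesgue k" by (simp add: set_integrable_def k_def[abs_def])
  then have "integrable lborel k"
    by (subst (asm) integrable_completion) (auto simp: k_def[abs_def])
  then have "AE t in lborel. integrable lborel (\<lambda>s. k (t - s) * g s)"
    using g by (rule AE_integrable_convolution)
  then have "AE t in lebesgue. integrable lborel (\<lambda>s. k (t - s) * g s)"
    by (rule AE_completion)
  then show ?thesis
  proof eventually_elim
    case (elim t)
    show ?case
    proof
      assume "t \<le> L"
      have "(\<lambda>s. k (t - s) * g s) \<in> borel_measurable borel"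
        using elim by auto
      then have "integrable lebesgue (\<lambda>s. k (t - s) * g s)"
        using elim by (simp add: integrable_completion)
      then have "set_integrable lebesgue {0..t} (\<lambda>s. k (t - s) * g s)"
        by (rule integrable_imp_set_integrable) simp
      then show "set_integrable lebesgue {0..t} (\<lambda>s. (t - s) powr p * g s)"
        by (rule set_integrable_cong[THEN iffD1, rotated -1]) (use \<open>t \<le> L\<close> in \<open>auto simp: k_def\<close>)
    qed
  qed
qed

lemma AE_lebesgue_iff_negligible: "(AE x in lebesgue. P x) \<longleftrightarrow> negligible {x. \<not> P x}"
  by (simp add: completion.AE_iff_null_sets negligible_iff_null_sets)

lemma AE_lebesgue_translation:
  fixes c :: real
  assumes "AE x in lebesgue. P x"
  shows "AE x in lebesgue. P (x + c)"
proof -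
  have "negligible ((+) (- c) ` {x. \<not> P x})"
    using assms unfolding AE_lebesgue_iff_negligible by (rule negligible_translation)
  moreover have "(+) (- c) ` {x. \<not> P x} = {x. \<not> P (x + c)}"
    by (force simp: image_iff)
  ultimately show ?thesis unfolding AE_lebesgue_iff_negligible by simp
qed

text \<open>A null set contains no interval.\<close>

lemma continuous_AE_eq_zero:
  fixes J :: "real \<Rightarrow> real"
  assumes cont: "continuous_on {c<..<d} J" and ae: "AE t in lebesgue. c < t \<longrightarrow> t < d \<longrightarrow> J t = 0"
    and t: "c < t" "t < d"
  shows "J t = 0"
proof (rule ccontr)
  assume "J t \<noteq> 0"
  have "open ({c<..<d} \<inter> J -` (- {0}))"
    using cont by (intro continuous_open_preimage) auto
  moreover have "t \<in> {c<..<d} \<inter> J -` (- {0})" using t \<open>J t \<noteq> 0\<close> by simp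
  ultimately obtain e where e: "e > 0" "cball t e \<subseteq> {c<..<d} \<inter> J -` (- {0})"
    using open_contains_cball by blast
  have "{t - e..t + e} \<subseteq> {x. \<not> (c < x \<longrightarrow> x < d \<longrightarrow> J x = 0)}"
    using e(2) by (auto simp: cball_eq_atLeastAtMost)
  then have "negligible {t - e..t + e}"
    using ae unfolding AE_lebesgue_iff_negligible by (rule negligible_subset[rotated])
  then show False using e(1) negligible_interval(1)[of "t - e" "t + e"] by simp
qed

lemma lebesgue_integral_cong_AE:
  fixes f g :: "real \<Rightarrow> real"
  assumes "f \<in> borel_measurable lebesgue" "AE x in lebesgue. f x = g x"
  shows "integral\<^sup>L lebesgue f = integral\<^sup>L lebesgue g"
  using assms borel_measurable_AE[OF assms] by (intro integral_cong_AE) auto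

text \<open>Dominated convergence; the distance from \<open>b\<close> to \<open>c\<close> bounds the kernel.\<close>

lemma powr_kernel_integral_continuous_on:
  fixes f :: "real \<Rightarrow> real"
  assumes f: "integrable lebesgue f" and "p < 0" "b < c"
  shows "continuous_on {c<..<d} (\<lambda>t. LINT s:{a..b}|lebesgue. (t - s) powr p * f s)"
  unfolding continuous_on_sequentially
proof (intro allI ballI impI, elim conjE)
  fix x t assume x: "\<forall>n. x n \<in> {c<..<d}" and t: "t \<in> {c<..<d}" and lim: "x \<longlonglongrightarrow> t"
  have meas: "(\<lambda>s. indicat_real {a..b} s *\<^sub>R ((r - s) powr p * f s)) \<in> borel_measurable lebesgue" if "r > b" for r
    using set_integrable_continuous_mult[OF f powr_kernel_continuous_on[OF that]]
    by (auto simp: set_integrable_def)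
  have "(\<lambda>n. LINT s|lebesgue. indicat_real {a..b} s *\<^sub>R ((x n - s) powr p * f s)) \<longlonglongrightarrow>
      (LINT s|lebesgue. indicat_real {a..b} s *\<^sub>R ((t - s) powr p * f s))"
  proof (rule integral_dominated_convergence)
    show "(\<lambda>s. indicat_real {a..b} s *\<^sub>R ((t - s) powr p * f s)) \<in> borel_measurable lebesgue"
      using t \<open>b < c\<close> by (intro meas) auto
    show "(\<lambda>s. indicat_real {a..b} s *\<^sub>R ((x n - s) powr p * f s)) \<in> borel_measurable lebesgue" for n
      using x[rule_format, of n] \<open>b < c\<close> by (intro meas) auto
    show "integrable lebesgue (\<lambda>s. (c - b) powr p * \<bar>f s\<bar>)" using f by simp
    show "AE s in lebesgue. (\<lambda>n. indicat_real {a..b} s *\<^sub>R ((x n - s) powr p * f s)) \<longlonglongrightarrow>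
        indicat_real {a..b} s *\<^sub>R ((t - s) powr p * f s)"
    proof (rule AE_I2)
      fix s
      show "(\<lambda>n. indicat_real {a..b} s *\<^sub>R ((x n - s) powr p * f s)) \<longlonglongrightarrow>
        indicat_real {a..b} s *\<^sub>R ((t - s) powr p * f s)"
      proof (cases "s \<in> {a..b}")
        case True
        then have "t - s \<noteq> 0" using t \<open>b < c\<close> by auto
        then have "(\<lambda>n. (x n - s) powr p) \<longlonglongrightarrow> (t - s) powr p"
          by (intro tendsto_intros lim) simp
        then show ?thesis by (intro tendsto_scaleR tendsto_mult tendsto_const)
      qed simp
    qed
    show "AE s in lebesgue. norm (indicat_real {a..b} s *\<^sub>R ((x n - s) powr p * f s)) \<le> (c - b) powr p * \<bar>f s\<bar>" for n
    proof (rule AE_I2)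
      fix s
      show "norm (indicat_real {a..b} s *\<^sub>R ((x n - s) powr p * f s)) \<le> (c - b) powr p * \<bar>f s\<bar>"
      proof (cases "s \<in> {a..b}")
        case True
        then have "(x n - s) powr p \<le> (c - b) powr p"
          using x[rule_format, of n] \<open>b < c\<close> \<open>p < 0\<close> by (intro powr_mono2') auto
        then show ?thesis using True by (simp add: abs_mult mult_right_mono)
      qed simp
    qed
  qed
  then show "((\<lambda>t. LINT s:{a..b}|lebesgue. (t - s) powr p * f s) \<circ> x) \<longlonglongrightarrow>
      (LINT s:{a..b}|lebesgue. (t - s) powr p * f s)"
    by (simp only: set_lebesgue_integral_def o_def)
qed

lemma deriv_periodic:
  fixes u :: "real \<Rightarrow> real"
  assumes "\<And>t. u (t + T) = u t"
  shows "deriv u (s + T) = deriv u s"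
  unfolding deriv_def DERIV_shift assms ..

text \<open>Periodicity moves the Caputo integral at \<open>t + T\<close> to one at \<open>t\<close> whose memory starts a period earlier.\<close>

lemma caputo_integral_shift:
  fixes v :: "real \<Rightarrow> real"
  assumes "\<And>s. v (s + T) = v s"
  shows "(LINT s:{0..t + T}|lebesgue. (t + T - s) powr p * v s) = (LINT s:{-T..t}|lebesgue. (t - s) powr p * v s)"
proof -
  have "(LINT s:{0..t + T}|lebesgue. (t + T - s) powr p * v s) =
      (LINT s|lebesgue. indicat_real {0..t + T} (T + 1 * s) *\<^sub>R ((t + T - (T + 1 * s)) powr p * v (T + 1 * s)))"
    unfolding set_lebesgue_integral_def
    by (subst lebesgue_integral_real_affine[of 1 _ T]) auto
  also have "\<dots> = (LINT s:{-T..t}|lebesgue. (t - s) powr p * v s)"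
    unfolding set_lebesgue_integral_def
  proof (rule Bochner_Integration.integral_cong[OF refl])
    fix s
    have "indicat_real {0..t + T} (T + 1 * s) = indicat_real {-T..t} s"
      by (auto split: split_indicator)
    moreover have "v (T + 1 * s) = v s" using assms[of s] by (simp add: add.commute)
    ultimately show "indicat_real {0..t + T} (T + 1 * s) *\<^sub>R ((t + T - (T + 1 * s)) powr p * v (T + 1 * s)) =
        indicat_real {-T..t} s *\<^sub>R ((t - s) powr p * v s)" by simp
  qed
  finally show ?thesis .
qed

text \<open>Measurability of \<open>v\<close>, which will be \<open>deriv u\<close>, comes from its equality with \<open>g\<close> almost everywhere,
  since Lebesgue measure is complete.\<close>

lemma caputo_integral_cong_AE:
  fixes v g :: "real \<Rightarrow> real"
  assumes g: "g \<in> borel_measurable borel" and ae: "AE s in lebesgue. a < s \<longrightarrow> s < b \<longrightarrow> v s = g s"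
    and "a \<le> c" "d \<le> b"
  shows "(LINT s:{c..d}|lebesgue. (t - s) powr p * v s) = (LINT s:{c..d}|lebesgue. (t - s) powr p * g s)"
  unfolding set_lebesgue_integral_def
proof (rule lebesgue_integral_cong_AE[symmetric])
  have "(\<lambda>s. indicat_real {c..d} s *\<^sub>R ((t - s) powr p * g s)) \<in> borel_measurable borel"
    using g by measurable
  then show "(\<lambda>s. indicat_real {c..d} s *\<^sub>R ((t - s) powr p * g s)) \<in> borel_measurable lebesgue"
    using measurable_completion measurable_lborel2 by metis
  have "AE s in lebesgue. s \<noteq> a" "AE s in lebesgue. s \<noteq> b"
    by (simp_all add: AE_lebesgue_iff_negligible)
  with ae show "AE s in lebesgue. indicat_real {c..d} s *\<^sub>R ((t - s) powr p * g s) =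
      indicat_real {c..d} s *\<^sub>R ((t - s) powr p * v s)"
    by eventually_elim (use \<open>a \<le> c\<close> \<open>d \<le> b\<close> in \<open>auto split: split_indicator\<close>)
qed

lemma periodic_const:
  fixes u :: "real \<Rightarrow> real"
  assumes "T > 0" and per: "\<And>t. u (t + T) = u t" and const: "\<And>t. - T \<le> t \<Longrightarrow> t \<le> 0 \<Longrightarrow> u t = u0"
  shows "u t = u0"
proof -
  have nat: "u (t + real n * T) = u t" for t n
    by (induction n) (use per in \<open>auto simp: algebra_simps, metis add.assoc add.commute\<close>)
  define m where "m = \<lceil>t / T\<rceil>"
  define r where "r = t - of_int m * T"
  have "t / T \<le> of_int m" "of_int m < t / T + 1" unfolding m_def by linarith+
  then have r: "- T \<le> r" "r \<le> 0" using \<open>T > 0\<close> by (auto simp: r_def field_simps)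
  have "u t = u r"
  proof (cases "m \<ge> 0")
    case True
    then have "t = r + real (nat m) * T" by (simp add: r_def)
    then show ?thesis using nat[of r "nat m"] by simp
  next
    case False
    then have "r = t + real (nat (- m)) * T" by (simp add: r_def)
    then show ?thesis using nat[of t "nat (- m)"] by simp
  qed
  then show ?thesis using const[OF r] by simp
qed

theorem theorem5p1:
  fixes \<alpha> T :: real and \<phi> u :: "real \<Rightarrow> real"
  assumes "0 < \<alpha>" and "\<alpha> < 1"
    and "continuous_on UNIV \<phi>"
    and "locally_abs_continuous u"
    and "T > 0" and "\<forall>t. u (t + T) = u t"
    and "AE t in lebesgue. t \<ge> 0 \<longrightarrow> caputo_deriv \<alpha> u t = \<phi> (u t)"
  shows "\<exists>u\<^sub>0. (\<forall>t. u t = u\<^sub>0) \<and> \<phi> u\<^sub>0 = 0"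
proof -
  let ?K = "\<lambda>a b t v. LINT s:{a..b}|lebesgue. (t - s) powr (- \<alpha>) * v s"
  have per: "u (t + T) = u t" for t using assms(6) by blast
  have caputo: "AE t in lebesgue. t \<ge> 0 \<longrightarrow> caputo_deriv \<alpha> u t = \<phi> (u t)" by fact
  have "abs_continuous_on {-T..T} u" using assms(4) by (simp add: locally_abs_continuous_def)
  then obtain g where g: "integrable lborel g"
    and deriv_g: "AE s in lebesgue. - T < s \<longrightarrow> s < T \<longrightarrow> deriv u s = g s"
    and int_g: "\<And>y z. - T \<le> y \<Longrightarrow> y \<le> z \<Longrightarrow> z \<le> T \<Longrightarrow> u z - u y = (LINT s:{y..z}|lebesgue. g s)"
    using abs_continuous_on_fundamental_theorem[of "-T" T u] \<open>T > 0\<close> by auto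
  have g_meas: "g \<in> borel_measurable borel" using g by auto
  have g_leb: "integrable lebesgue g" using g g_meas by (simp add: integrable_completion)
  have caputo_shift: "AE t in lebesgue. t + T \<ge> 0 \<longrightarrow> caputo_deriv \<alpha> u (t + T) = \<phi> (u (t + T))"
    using AE_lebesgue_translation[OF caputo] .
  have int_near: "AE t in lebesgue. t \<le> T \<longrightarrow> set_integrable lebesgue {0..t} (\<lambda>s. (t - s) powr (- \<alpha>) * g s)"
    using g assms by (intro AE_integrable_powr_kernel) auto
  \<comment> \<open>The memory of the period before time 0 has no influence at time \<open>t\<close>.\<close>
  have ae: "AE t in lebesgue. 0 < t \<longrightarrow> t < T \<longrightarrow> ?K (-T) 0 t g = 0"
    using caputo caputo_shift int_near
  proof eventually_elim
    case (elim t)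
    show ?case
    proof (intro impI)
      assume t: "0 < t" "t < T"
      \<comment> \<open>Both sides are \<open>\<phi> (u t)\<close>.\<close>
      have "caputo_deriv \<alpha> u t = caputo_deriv \<alpha> u (t + T)"
        using elim(1,2) t \<open>T > 0\<close> per by simp
      moreover have "Gamma (1 - \<alpha>) > 0" using assms by (intro Gamma_real_pos) simp
      ultimately have "?K 0 t t (deriv u) = ?K 0 (t + T) (t + T) (deriv u)"
        by (simp add: caputo_deriv_def)
      also have "\<dots> = ?K (-T) t t (deriv u)"
        by (rule caputo_integral_shift, rule deriv_periodic, rule per)
      finally have "?K 0 t t g = ?K (-T) t t g"
        using caputo_integral_cong_AE[OF g_meas deriv_g, of 0 t t "- \<alpha>"]
          caputo_integral_cong_AE[OF g_meas deriv_g, of "-T" t t "- \<alpha>"] t by simp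
      also have "{-T..t} = {-T..0} \<union> {0..t}" using t by auto
      also have "(LINT s:({-T..0} \<union> {0..t})|lebesgue. (t - s) powr (- \<alpha>) * g s) = ?K (-T) 0 t g + ?K 0 t t g"
      proof (rule set_integral_Un_AE)
        have "AE s::real in lebesgue. s \<noteq> 0" by (simp add: AE_lebesgue_iff_negligible)
        then show "AE s in lebesgue. \<not> (s \<in> {-T..0} \<and> s \<in> {0..t})"
          by eventually_elim auto
        show "set_integrable lebesgue {-T..0} (\<lambda>s. (t - s) powr (- \<alpha>) * g s)"
          using g_leb powr_kernel_continuous_on[OF t(1)] by (rule set_integrable_continuous_mult)
        show "set_integrable lebesgue {0..t} (\<lambda>s. (t - s) powr (- \<alpha>) * g s)"
          using elim(3) t by simp
      qed auto
      finally show "?K (-T) 0 t g = 0" by simp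
    qed
  qed
  \<comment> \<open>For \<open>t > c > 0\<close> the kernel is bounded on \<open>{-T..0}\<close>, so the integral depends continuously on \<open>t\<close>.\<close>
  have zero: "?K (-T) 0 t g = 0" if "0 < t" "t < T" for t
  proof -
    obtain c where c: "0 < c" "c < t" using dense[OF \<open>0 < t\<close>] by blast
    show ?thesis
    proof (rule continuous_AE_eq_zero[where J = "\<lambda>t. ?K (-T) 0 t g" and c = c and d = T])
      show "continuous_on {c<..<T} (\<lambda>t. ?K (-T) 0 t g)"
        using g_leb _ c(1) by (rule powr_kernel_integral_continuous_on) (use assms in simp)
      show "AE t in lebesgue. c < t \<longrightarrow> t < T \<longrightarrow> ?K (-T) 0 t g = 0"
        using ae by eventually_elim (use c in auto)
    qed (use c that in auto)
  qed
  have const: "u t = u (- T)" if "- T \<le> t" "t \<le> 0" for t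
  proof -
    have "(LINT s:{-T..t}|lebesgue. g s) = 0"
      using g_leb _ \<open>T > 0\<close> zero that(2)
      by (rule powr_kernel_integral_zero_imp_integral_zero) (use assms in auto)
    then show ?thesis using int_g[of "-T" t] that \<open>T > 0\<close> by simp
  qed
  have const': "u t = u (- T)" for t
    using \<open>T > 0\<close> per const by (rule periodic_const)
  then have "deriv u s = 0" for s
  proof -
    have "u = (\<lambda>_. u (- T))" using const' by blast
    then show ?thesis by (metis deriv_const)
  qed
  then have caputo_zero: "caputo_deriv \<alpha> u t = 0" for t by (simp add: caputo_deriv_def)
  have "AE t::real in lebesgue. 0 < t \<longrightarrow> t < 1 \<longrightarrow> \<phi> (u (- T)) = 0"
    using caputo
  proof eventually_elim
    case (elim t)
    then show ?case using caputo_zero[of t] const'[of t] by simp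
  qed
  then have "\<phi> (u (- T)) = 0"
    using continuous_AE_eq_zero[of 0 1 "\<lambda>_. \<phi> (u (- T))" "1/2"] by simp
  then show ?thesis using const' by blast
qed

end
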